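(* Let $\nu_1,\nu_3,\nu_4\in\mathbb{C}$ with $\Re\nu_1>0$, and consider the differential equation $$u'\,[u''\,t(t-1)]^2+\left[2u'(tu'-u)-u'^2-\nu_1^2\,\nu_3\,\nu_4\right]^2=(u'+\nu_1^2)^2(u'+\nu_3^2)(u'+\nu_4^2)\qquad(\ast)$$ for $u=u(t)$. Let $\mathcal{S}$ be any fixed sector at infinity. Then for every $C\in\mathbb{C}$, equation $(\ast)$ has a unique solution $u$, analytic in $\mathcal{S}$ for large $|t|$, satisfying $$u(t)=-\nu_1^2\,t+\tfrac12\left(\nu_1^2+\nu_3\nu_4\right)+C\,t^{-2\nu_1}+o\!\left(t^{-2\nu_1}\right)\qquad\text{as } t\to\infty \text{ in } \mathcal{S}.$$
   Context: A prime denotes $d/dt$, with $t$ a complex variable. A sector at infinity is a set of the form $\{t : A<\arg t<B\}$ with real $A<B$, regarded as a subset of $\mathbb{C}\setminus\{0\}$ if $B\le A+2\pi$ and as a subset of the Riemann surface of the logarithm (universal cover of $\mathbb{C}\setminus\{0\}$) otherwise. The power $t^{-2\nu_1}=\exp(-2\nu_1\log t)$ is taken with a fixed branch of $\log t$ on $\mathcal{S}$, the one determined by $\arg t\in(A,B)$. Solutions are analytic functions on $\{t\in\mathcal{S}:|t|>\rho\}$ for some $\rho>0$, which may depend on the solution. Uniqueness means that two such solutions with the stated asymptotics, for the same $C$ and $\mathcal{S}$, coincide for all sufficiently large $|t|$ in $\mathcal{S}$. The notation $g(t)=o(t^{-2\nu_1})$ as $t\to\infty$ in $\mathcal{S}$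 means $g(t)\,t^{2\nu_1}\to0$ as $|t|\to\infty$, $t\in\mathcal{S}$. *)

theory Defs
  imports "HOL-Complex_Analysis.Complex_Analysis"
begin

text \<open>The differential equation, as a relation between \<^term>\<open>t\<close> and the values
  \<^term>\<open>u0\<close>, \<^term>\<open>u1\<close>, \<^term>\<open>u2\<close> of the unknown function and its first two
  derivatives with respect to \<^term>\<open>t\<close>.\<close>

definition ode :: "complex \<Rightarrow> complex \<Rightarrow> complex \<Rightarrow> complex \<Rightarrow> complex \<Rightarrow> complex \<Rightarrow> complex \<Rightarrow> bool" where
  "ode \<nu>1 \<nu>3 \<nu>4 t u0 u1 u2 \<longleftrightarrow>
     u1 * (u2 * t * (t - 1))\<^sup>2 + (2 * u1 * (t * u1 - u0) - u1\<^sup>2 - \<nu>1\<^sup>2 * \<nu>3 * \<nu>4)\<^sup>2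
       = (u1 + \<nu>1\<^sup>2)\<^sup>2 * (u1 + \<nu>3\<^sup>2) * (u1 + \<nu>4\<^sup>2)"

text \<open>Here \<^term>\<open>l\<close> is the value of \<open>log t\<close> that determines the power of \<^term>\<open>t\<close> with
  exponent \<open>-2 \<nu>1\<close>.\<close>

definition expansion :: "complex \<Rightarrow> complex \<Rightarrow> complex \<Rightarrow> complex \<Rightarrow> complex \<Rightarrow> complex \<Rightarrow> complex" where
  "expansion \<nu>1 \<nu>3 \<nu>4 C t l = - \<nu>1\<^sup>2 * t + (\<nu>1\<^sup>2 + \<nu>3 * \<nu>4) / 2 + C * exp (- 2 * \<nu>1 * l)"


subsection \<open>Sectors in the punctured plane (opening at most \<open>2\<pi>\<close>)\<close>

definition sector :: "real \<Rightarrow> real \<Rightarrow> complex set" where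
  "sector A B = {rcis r \<theta> | r \<theta>. 0 < r \<and> A < \<theta> \<and> \<theta> < B}"

definition sector_log :: "real \<Rightarrow> real \<Rightarrow> complex \<Rightarrow> complex" where
  "sector_log A B t = (THE w. exp w = t \<and> A < Im w \<and> Im w < B)"

lemma sector_log:
  assumes "B \<le> A + 2 * pi" "t \<in> sector A B"
  shows "exp (sector_log A B t) = t" "A < Im (sector_log A B t)" "Im (sector_log A B t) < B"
proof -
  obtain r \<theta> where t: "t = rcis r \<theta>" "0 < r" "A < \<theta>" "\<theta> < B"
    using assms(2) unfolding sector_def by blast
  define w where "w = Complex (ln r) \<theta>"
  have w: "Re w = ln r" "Im w = \<theta>"
    by (simp_all add: w_def)
  have exp_w: "exp w = t"
    unfolding exp_eq_polar[of w] w rcis_def t(1) using t(2) by simp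
  have "v = w" if "exp v = t" "A < Im v" "Im v < B" for v
  proof (rule exp_complex_eqI)
    show "\<bar>Im v - Im w\<bar> < 2 * pi"
      using that(2,3) t(3,4) assms(1) unfolding w by linarith
    show "exp v = exp w"
      unfolding exp_w by (rule that(1))
  qed
  then have "\<exists>!w. exp w = t \<and> A < Im w \<and> Im w < B"
    using exp_w w t(3,4) by metis
  from theI'[OF this]
  show "exp (sector_log A B t) = t" "A < Im (sector_log A B t)" "Im (sector_log A B t) < B"
    unfolding sector_log_def by blast+
qed

definition solution_plane ::
    "complex \<Rightarrow> complex \<Rightarrow> complex \<Rightarrow> complex \<Rightarrow> real \<Rightarrow> real \<Rightarrow> (complex \<Rightarrow> complex) \<Rightarrow> bool" where
  "solution_plane \<nu>1 \<nu>3 \<nu>4 C A B u \<longleftrightarrow>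
     (\<exists>\<rho>>0. u analytic_on {t \<in> sector A B. norm t > \<rho>} \<and>
        (\<forall>t \<in> sector A B. norm t > \<rho> \<longrightarrow> ode \<nu>1 \<nu>3 \<nu>4 t (u t) (deriv u t) (deriv (deriv u) t))) \<and>
     ((\<lambda>t. (u t - expansion \<nu>1 \<nu>3 \<nu>4 C t (sector_log A B t)) * exp (2 * \<nu>1 * sector_log A B t))
        \<longlongrightarrow> 0) (inf at_infinity (principal (sector A B)))"


subsection \<open>Sectors on the Riemann surface of the logarithm (any opening)\<close>

text \<open>A point of the Riemann surface of the logarithm is represented by its logarithm
  \<^term>\<open>w\<close>, a global holomorphic coordinate in which the covering map is \<open>t = exp w\<close> and
  \<open>arg t = Im w\<close>. A function on the surface is thus a function of \<^term>\<open>w\<close>, and by the chain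
  rule \<open>d/dt = exp (-w) d/dw\<close>.\<close>

definition log_sector :: "real \<Rightarrow> real \<Rightarrow> complex set" where
  "log_sector A B = {w. A < Im w \<and> Im w < B}"

definition deriv_t :: "(complex \<Rightarrow> complex) \<Rightarrow> complex \<Rightarrow> complex" where
  "deriv_t u w = deriv u w / exp w"

lemma deriv_t_comp_exp:
  assumes "f field_differentiable at (exp w)"
  shows "deriv_t (f \<circ> exp) w = deriv f (exp w)"
proof -
  have "deriv (f \<circ> exp) w = deriv f (exp w) * exp w"
    using assms by (intro DERIV_imp_deriv DERIV_chain DERIV_exp) (rule field_differentiable_derivI)
  then show ?thesis
    unfolding deriv_t_def by simp
qed

definition solution_log ::
    "complex \<Rightarrow> complex \<Rightarrow> complex \<Rightarrow> complex \<Rightarrow> real \<Rightarrow> real \<Rightarrow> (complex \<Rightarrow> complex) \<Rightarrow> bool" where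
  "solution_log \<nu>1 \<nu>3 \<nu>4 C A B u \<longleftrightarrow>
     (\<exists>\<rho>>0. u analytic_on {w \<in> log_sector A B. norm (exp w) > \<rho>} \<and>
        (\<forall>w \<in> log_sector A B. norm (exp w) > \<rho> \<longrightarrow>
           ode \<nu>1 \<nu>3 \<nu>4 (exp w) (u w) (deriv_t u w) (deriv_t (deriv_t u) w))) \<and>
     ((\<lambda>w. (u w - expansion \<nu>1 \<nu>3 \<nu>4 C (exp w) w) * exp (2 * \<nu>1 * w))
        \<longlongrightarrow> 0) (inf (filtercomap exp at_infinity) (principal (log_sector A B)))"

end

theory Submission
  imports Defs
begin

text \<open>
  Put \<open>w = log t\<close>, \<open>x = 1/t\<close>, \<open>q = t\<^sup>-\<^sup>2\<^sup>\<nu>\<close> and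
  \<open>u = - \<nu>\<^sup>2 t + (\<nu>\<^sup>2 + \<nu>3 \<nu>4)/2 + y\<close>. Differentiating the equation and dividing by \<open>u''\<close> gives an
  equation linear in \<open>u'''\<close>; the difference of the two sides of the original equation is a first
  integral of it. In terms of \<open>y = q Y\<close>, \<open>t y' - y = q Z\<close>, \<open>t (t - 1) y'' = q V\<close> and \<open>d/dw\<close>, the
  third-order equation is a first-order system whose linear part has the eigenvalues \<open>1 + 2\<nu>\<close>,
  \<open>4\<nu>\<close> and \<open>0\<close>, and all of whose nonlinear terms carry the factor \<open>x\<close>. As no eigenvalue has a
  negative real part, integration from infinity turns the system into a contraction on functions of
  size \<open>O(|x|)\<close> in a half-strip, whatever the value \<open>C\<close> of \<open>Y\<close> at infinity. The first integral
  tends to \<open>0\<close>, hence vanishes, and so the fixed point solves the original equation. Conversely,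
  Cauchy estimates show that along a ray every solution of the original equation tends to the same
  point of the phase space, the contraction argument yields uniqueness there, and the identity
  theorem extends it.
\<close>

subsection \<open>Linear and semilinear equations on a half-strip\<close>

text \<open>Solving the original equation for \<open>u''\<close> needs a square root that branches
  at the very point to which solutions tend: with \<open>p = u' + \<nu>^2\<close>,
  \<open>z = t y' - y\<close>, \<open>v = t (t - 1) y''\<close>, all its terms vanish to second
  order at \<open>p = z = v = 0\<close>. Differentiation removes the root, at two costs: an
  additional constant, the value of the first integral, and the functions with \<open>u''\<close>
  identically 0, for which the division is not allowed. In terms of \<open>d/dw\<close>, the linear
  part for \<open>(y, z, v)\<close> has the rows \<open>y + z\<close>, \<open>v\<close>,
  \<open>4 \<nu>^2 z\<close> and the eigenvalues \<open>1\<close>, \<open>2 \<nu>\<close>,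
  \<open>- 2 \<nu>\<close>. Taking out \<open>q\<close> shifts them by \<open>2 \<nu>\<close>, so
  that the wanted mode becomes the neutral one. Its direction
  \<open>(1, - (1 + 2 \<nu>), 2 \<nu> (1 + 2 \<nu>))\<close> in \<open>(Y, Z, V)\<close> explains
  why \<open>C\<close> alone fixes the limit point; the other two modes grow and leave no freedom.
  The neutral mode, driven by terms of size \<open>O(|x|)\<close>, still converges, since
  \<open>|x| = exp (- Re w)\<close> is integrable along horizontal rays. The factor \<open>q\<close>
  is bounded because \<open>Re \<nu> > 0\<close> and the strip has finite width.\<close>

definition halfstrip :: "real \<Rightarrow> real \<Rightarrow> real \<Rightarrow> complex set" where
  "halfstrip A B R = {w. A < Im w \<and> Im w < B \<and> R < Re w}"

lemma halfstrip_eq: "halfstrip A B R = {w. A < Im w} \<inter> {w. Im w < B} \<inter> {w. R < Re w}"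
  by (auto simp: halfstrip_def)

lemma open_halfstrip: "open (halfstrip A B R)"
  unfolding halfstrip_eq
  by (intro open_Int open_halfspace_Im_gt open_halfspace_Im_lt open_halfspace_Re_gt)

lemma convex_halfstrip: "convex (halfstrip A B R)"
  unfolding halfstrip_eq
  by (intro convex_Int convex_halfspace_Im_gt convex_halfspace_Im_lt convex_halfspace_Re_gt)

lemma halfstrip_add_real: "w \<in> halfstrip A B R \<Longrightarrow> 0 \<le> s \<Longrightarrow> w + of_real s \<in> halfstrip A B R"
  by (simp add: halfstrip_def)

lemma halfstrip_mono: "R \<le> R' \<Longrightarrow> halfstrip A B R' \<subseteq> halfstrip A B R"
  by (auto simp: halfstrip_def)

section \<open>Integration along horizontal rays\<close>

lemma has_vector_derivative_along_ray:
  assumes "(f has_field_derivative f') (at (w + of_real s))"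
  shows "((\<lambda>s. f (w + of_real s)) has_vector_derivative f') (at s)"
proof -
  have "((\<lambda>s. w + of_real s) has_vector_derivative 1) (at s)"
    by (auto intro!: derivative_eq_intros)
  from field_vector_diff_chain_at[OF this assms] show ?thesis
    by (simp add: o_def)
qed

text \<open>Comparison with the real majorant \<open>- K * exp (- s)\<close>. Two endpoints are kept
  because the same bound later gives the Cauchy property at infinity.\<close>

lemma ray_increment_bound:
  assumes der: "\<And>s. 0 \<le> s \<Longrightarrow> (f has_field_derivative f' (w + of_real s)) (at (w + of_real s))"
    and bound: "\<And>s. 0 \<le> s \<Longrightarrow> norm (f' (w + of_real s)) \<le> K * exp (- s)"
    and "0 \<le> a" "a \<le> b"
  shows "norm (f (w + of_real b) - f (w + of_real a)) \<le> K * (exp (- a) - exp (- b))"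
proof (cases "a = b")
  case False
  have vd: "((\<lambda>s. f (w + of_real s)) has_vector_derivative f' (w + of_real s)) (at s)" if "0 \<le> s" for s
    by (rule has_vector_derivative_along_ray[OF der[OF that]])
  have "norm (f (w + of_real b) - f (w + of_real a)) \<le> (- K * exp (- b)) - (- K * exp (- a))"
  proof (rule differentiable_bound_general)
    show "a < b" using False assms(4) by simp
    show "continuous_on {a..b} (\<lambda>s. f (w + of_real s))"
      using vd assms(3) by (intro continuous_at_imp_continuous_on ballI has_vector_derivative_continuous[OF vd]) auto
    show "continuous_on {a..b} (\<lambda>s. - K * exp (- s))"
      by (intro continuous_intros)
    show "((\<lambda>s. f (w + of_real s)) has_vector_derivative f' (w + of_real s)) (at s)" if "a < s" for s
      using vd assms(3) that by simp
    show "((\<lambda>s. - K * exp (- s)) has_vector_derivative K * exp (- s)) (at s)" for s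
      unfolding has_real_derivative_iff_has_vector_derivative[symmetric]
      by (auto intro!: derivative_eq_intros)
    show "norm (f' (w + of_real s)) \<le> K * exp (- s)" if "a < s" for s
      using bound assms(3) that by simp
  qed
  then show ?thesis by (simp add: algebra_simps)
qed simp

text \<open>A solution that vanishes at infinity inherits the decay of the inhomogeneity, with the same
  constant, because \<open>Re \<mu> \<ge> 0\<close>.\<close>

lemma linear_ode_decay:
  assumes der: "\<And>s. 0 \<le> s \<Longrightarrow> (f has_field_derivative \<mu> * f (w + of_real s) + e (w + of_real s)) (at (w + of_real s))"
    and bound: "\<And>s. 0 \<le> s \<Longrightarrow> norm (e (w + of_real s)) \<le> K * exp (- Re w - s)"
    and "Re \<mu> \<ge> 0"
    and lim: "((\<lambda>s. f (w + of_real s)) \<longlongrightarrow> 0) at_top"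
  shows "norm (f w) \<le> K * exp (- Re w)"
proof -
  \<comment> \<open>Integrating factor normalised to 1 at the starting point \<open>w\<close>. It is
    bounded by 1 on the ray since \<open>Re \<mu> \<ge> 0\<close>, so \<open>\<phi>\<close> keeps
    the limit 0 and its derivative the bound on \<open>e\<close>.\<close>
  define \<phi> where "\<phi> z = exp (- \<mu> * (z - w)) * f z" for z
  define \<phi>' where "\<phi>' z = exp (- \<mu> * (z - w)) * e z" for z
  have d: "(\<phi> has_field_derivative \<phi>' (w + of_real s)) (at (w + of_real s))" if "0 \<le> s" for s
    unfolding \<phi>_def \<phi>'_def
    by (rule derivative_eq_intros refl der[OF that])+ (simp add: algebra_simps)
  have exp1: "norm (exp (- \<mu> * of_real s)) \<le> 1" if "0 \<le> s" for s
    using that assms(3) by simp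
  have b: "norm (\<phi>' (w + of_real s)) \<le> K * exp (- Re w) * exp (- s)" if "0 \<le> s" for s
  proof -
    have "norm (\<phi>' (w + of_real s)) \<le> 1 * (K * exp (- Re w - s))"
      unfolding \<phi>'_def norm_mult using exp1[OF that] bound[OF that]
      by (intro mult_mono) auto
    then show ?thesis by (simp add: exp_add[symmetric] mult.assoc)
  qed
  have incr: "norm (\<phi> (w + of_real s) - \<phi> w) \<le> K * exp (- Re w) * (1 - exp (- s))" if "0 \<le> s" for s
    using ray_increment_bound[OF d b, of 0 s] that by simp
  have "((\<lambda>s. \<phi> (w + of_real s)) \<longlongrightarrow> 0) at_top"
  proof (rule Lim_null_comparison[OF _ tendsto_norm_zero[OF lim]])
    show "\<forall>\<^sub>F s in at_top. norm (\<phi> (w + of_real s)) \<le> norm (f (w + of_real s))"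
      using eventually_ge_at_top[of 0]
    proof eventually_elim
      case (elim s)
      show ?case unfolding \<phi>_def norm_mult using mult_right_mono[OF exp1[OF elim], of "norm (f (w + of_real s))"]
        by simp
    qed
  qed
  then have l1: "((\<lambda>s. norm (\<phi> (w + of_real s) - \<phi> w)) \<longlongrightarrow> norm (0 - \<phi> w)) at_top"
    by (intro tendsto_intros)
  have "((\<lambda>s::real. exp (- s)) \<longlongrightarrow> 0) at_top"
    by (intro filterlim_compose[OF exp_at_bot] filterlim_uminus_at_bot_at_top)
  then have l2: "((\<lambda>s. K * exp (- Re w) * (1 - exp (- s))) \<longlongrightarrow> K * exp (- Re w) * (1 - 0)) at_top"
    by (intro tendsto_intros)
  have "norm (0 - \<phi> w) \<le> K * exp (- Re w) * (1 - 0)"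
    by (rule tendsto_le[OF _ l2 l1]) (auto intro: eventually_mono[OF eventually_ge_at_top[of 0]] incr)
  then show ?thesis by (simp add: \<phi>_def)
qed

text \<open>Variation of constants started at infinity:
  \<open>f w = exp (\<mu> * w) * (F w - L)\<close> with \<open>F\<close> a primitive of
  \<open>exp (- \<mu> * w) * h w\<close> and \<open>L\<close> its limit along rays. Starting at
  infinity avoids the growth of \<open>exp (\<mu> * w)\<close> that a finite starting point would
  bring in.\<close>

lemma linear_ode_solution:
  assumes hol: "h holomorphic_on halfstrip A B R"
    and bound: "\<And>w. w \<in> halfstrip A B R \<Longrightarrow> norm (h w) \<le> K * exp (- Re w)"
    and "Re \<mu> \<ge> 0"
  obtains f where
    "\<And>w. w \<in> halfstrip A B R \<Longrightarrow> (f has_field_derivative \<mu> * f w + h w) (at w)"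
    "\<And>w. w \<in> halfstrip A B R \<Longrightarrow> norm (f w) \<le> K * exp (- Re w)"
proof (cases "halfstrip A B R = {}")
  case True
  then show ?thesis using that by auto
next
  case False
  define H where "H = halfstrip A B R"
  note H = open_halfstrip[of A B R, folded H_def] convex_halfstrip[of A B R, folded H_def]
    halfstrip_add_real[of _ A B R, folded H_def]
  note hol = hol[folded H_def] and bound = bound[folded H_def]
  obtain w0 where w0: "w0 \<in> H" using False H_def by auto
  define g where "g w = exp (- \<mu> * w) * h w" for w
  have g: "g holomorphic_on H" unfolding g_def by (intro holomorphic_intros hol)
  obtain F where "\<And>x. x \<in> H \<Longrightarrow> (F has_field_derivative g x) (at x within H)"
    using holomorphic_convex_primitive'[OF H(2) H(1) g] by blast
  then have F: "(F has_field_derivative g x) (at x)" if "x \<in> H" for x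
    using that at_within_open[OF that H(1)] by metis
  have gb: "norm (g (w + of_real s)) \<le> norm (exp (- \<mu> * w)) * K * exp (- Re w) * exp (- s)"
    if "w \<in> H" "0 \<le> s" for w s
  proof -
    have "norm (g (w + of_real s)) = norm (exp (- \<mu> * w)) * norm (exp (- \<mu> * of_real s)) * norm (h (w + of_real s))"
      unfolding g_def norm_mult[symmetric] exp_add[symmetric] by (simp add: algebra_simps)
    also have "\<dots> \<le> norm (exp (- \<mu> * w)) * 1 * (K * exp (- Re (w + of_real s)))"
      using that assms(3) by (intro mult_mono bound H(3)) auto
    finally show ?thesis by (simp add: exp_diff exp_minus field_simps)
  qed
  have incr: "norm (F (w + of_real b) - F (w + of_real a))
      \<le> norm (exp (- \<mu> * w)) * K * exp (- Re w) * (exp (- a) - exp (- b))"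
    if "w \<in> H" "0 \<le> a" "a \<le> b" for w a b
    by (rule ray_increment_bound[of F g, OF F[OF H(3)] gb]) (use that in auto)
  define M where "M w = norm (exp (- \<mu> * w)) * K * exp (- Re w)" for w
  have M0: "0 \<le> M w" if "w \<in> H" for w
    using order_trans[OF norm_ge_zero gb[OF that, of 0]] by (simp add: M_def)
  have exp0: "(\<lambda>n. exp (- real n)) \<longlonglongrightarrow> 0"
    by (intro filterlim_compose[OF exp_at_bot] filterlim_compose[OF filterlim_uminus_at_bot_at_top] filterlim_real_sequentially)
  \<comment> \<open>Integer steps along one ray suffice to produce the limit of
    \<open>F\<close>.\<close>
  have "Cauchy (\<lambda>n. F (w0 + of_nat n))"
  proof (rule metric_CauchyI)
    fix e :: real assume "e > 0"
    have "(\<lambda>n. M w0 * exp (- real n)) \<longlonglongrightarrow> M w0 * 0"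
      by (intro tendsto_intros exp0)
    then have "\<forall>\<^sub>F n in sequentially. M w0 * exp (- real n) < e"
      using \<open>e > 0\<close> by (intro order_tendstoD(2)[of _ "M w0 * 0"]) auto
    then obtain N where N: "M w0 * exp (- real N) < e"
      using eventually_happens[of _ sequentially] by auto
    have *: "dist (F (w0 + of_nat m)) (F (w0 + of_nat n)) < e" if "N \<le> n" "n \<le> m" for m n
    proof -
      have "dist (F (w0 + of_nat m)) (F (w0 + of_nat n)) \<le> M w0 * (exp (- real n) - exp (- real m))"
        using incr[OF w0, of "real n" "real m"] that by (simp add: dist_norm M_def)
      also have "\<dots> \<le> M w0 * exp (- real N)"
        using that by (intro mult_left_mono M0 w0) (smt (verit) exp_ge_zero exp_le_cancel_iff of_nat_mono)
      finally show ?thesis using N by simp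
    qed
    show "\<exists>M. \<forall>m\<ge>M. \<forall>n\<ge>M. dist (F (w0 + of_nat m)) (F (w0 + of_nat n)) < e"
    proof (intro exI allI impI)
      fix m n assume "N \<le> m" "N \<le> n"
      then show "dist (F (w0 + of_nat m)) (F (w0 + of_nat n)) < e"
        using *[of m n] *[of n m] by (cases "n \<le> m") (auto simp: dist_commute)
    qed
  qed
  then obtain L where L0: "(\<lambda>n. F (w0 + of_nat n)) \<longlonglongrightarrow> L"
    using Cauchy_convergent convergent_def by blast
  \<comment> \<open>The constant subtracted from \<open>F\<close> has to be the same on all rays.
    The segment from \<open>w0\<close> to \<open>w\<close>, shifted by \<open>n\<close>, keeps its
    length while \<open>g\<close> on it is of size \<open>exp (- n)\<close>.\<close>
  have L: "(\<lambda>n. F (w + of_nat n)) \<longlonglongrightarrow> L" if "w \<in> H" for w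
  proof -
    have "continuous_on (closed_segment w0 w) M"
      unfolding M_def by (intro continuous_intros)
    then have "bounded (M ` closed_segment w0 w)"
      by (intro compact_imp_bounded compact_continuous_image) auto
    then obtain c where c: "\<And>z. z \<in> closed_segment w0 w \<Longrightarrow> \<bar>M z\<bar> \<le> c"
      unfolding bounded_iff by auto
    have "norm (F (w + of_nat n) - F (w0 + of_nat n)) \<le> c * exp (- real n) * norm (w - w0)" for n
    proof -
      have seg: "closed_segment w0 w \<subseteq> H" by (simp add: H(2) closed_segment_subset w0 that)
      have "norm ((\<lambda>z. F (z + of_nat n)) w - (\<lambda>z. F (z + of_nat n)) w0) \<le> c * exp (- real n) * norm (w - w0)"
      proof (rule field_differentiable_bound[where S = "closed_segment w0 w" and f' = "\<lambda>z. g (z + of_nat n)"])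
        show "((\<lambda>z. F (z + of_nat n)) has_field_derivative g (z + of_nat n)) (at z within closed_segment w0 w)"
          if "z \<in> closed_segment w0 w" for z
        proof -
          have "z + of_nat n \<in> H" using H(3)[of z "real n"] seg that by auto
          have "((\<lambda>z. F (z + of_nat n)) has_field_derivative g (z + of_nat n)) (at z)"
            by (rule DERIV_shift[THEN iffD1, OF F[OF \<open>z + of_nat n \<in> H\<close>]])
          then show ?thesis by (rule has_field_derivative_at_within)
        qed
        show "norm (g (z + of_nat n)) \<le> c * exp (- real n)" if "z \<in> closed_segment w0 w" for z
        proof -
          have "norm (g (z + of_nat n)) \<le> M z * exp (- real n)"
            using gb[of z "real n"] seg that unfolding M_def by auto
          also have "\<dots> \<le> c * exp (- real n)"
            using c[OF that] by (intro mult_right_mono) auto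
          finally show ?thesis .
        qed
      qed auto
      then show ?thesis by simp
    qed
    moreover have "(\<lambda>n. c * exp (- real n) * norm (w - w0)) \<longlonglongrightarrow> c * 0 * norm (w - w0)"
      by (intro tendsto_intros exp0)
    ultimately have "(\<lambda>n. F (w + of_nat n) - F (w0 + of_nat n)) \<longlonglongrightarrow> 0"
      by - (rule Lim_null_comparison[where g = "\<lambda>n. c * exp (- real n) * norm (w - w0)", OF always_eventually], simp_all)
    from tendsto_add[OF this L0] show ?thesis by simp
  qed
  define f where "f w = exp (\<mu> * w) * (F w - L)" for w
  show ?thesis
  proof (rule that)
    fix w assume "w \<in> halfstrip A B R"
    then have w: "w \<in> H" by (simp add: H_def)
    have "(f has_field_derivative exp (\<mu> * w) * \<mu> * (F w - L) + g w * exp (\<mu> * w)) (at w)"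
      unfolding f_def
      by (intro DERIV_mult) (auto intro!: derivative_eq_intros F[OF w])
    also have "exp (\<mu> * w) * \<mu> * (F w - L) + g w * exp (\<mu> * w) = \<mu> * f w + h w * (exp (\<mu> * w) * exp (- \<mu> * w))"
      by (simp add: g_def f_def)
    finally show "(f has_field_derivative \<mu> * f w + h w) (at w)"
      by (simp add: exp_add[symmetric])
    have "(\<lambda>n. norm (F (w + of_nat n) - F w)) \<longlonglongrightarrow> norm (L - F w)"
      by (intro tendsto_intros L w)
    then have "norm (L - F w) \<le> M w"
    proof (rule tendsto_upperbound)
      show "\<forall>\<^sub>F n in sequentially. norm (F (w + of_nat n) - F w) \<le> M w"
      proof (intro always_eventually allI)
        fix n
        have "norm (F (w + of_nat n) - F w) \<le> M w * (1 - exp (- real n))"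
          using incr[OF w, of 0 "real n"] by (simp add: M_def)
        also have "\<dots> \<le> M w" using M0[OF w] by (simp add: algebra_simps)
        finally show "norm (F (w + of_nat n) - F w) \<le> M w" .
      qed
    qed simp
    then have "norm (f w) \<le> norm (exp (\<mu> * w)) * M w"
      unfolding f_def norm_mult by (intro mult_left_mono) (auto simp: norm_minus_commute)
    also have "\<dots> = norm (exp (\<mu> * w) * exp (- \<mu> * w)) * K * exp (- Re w)"
      by (simp add: M_def norm_mult)
    finally show "norm (f w) \<le> K * exp (- Re w)"
      by (simp add: exp_add[symmetric])
  qed
qed

section \<open>Picard iteration for semilinear systems\<close>

lemma exp_neg_real_tendsto_0: "((\<lambda>s::real. exp (- a - s)) \<longlongrightarrow> 0) at_top"
proof -
  have "((\<lambda>s::real. exp (- a) * exp (- s)) \<longlongrightarrow> exp (- a) * 0) at_top"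
    by (intro tendsto_intros filterlim_compose[OF exp_at_bot] filterlim_uminus_at_bot_at_top)
  then show ?thesis by (simp add: exp_add[symmetric])
qed

text \<open>Picard iteration in the sup norm weighted by \<open>exp (Re w)\<close>. Integration from
  infinity costs no constant, so the Lipschitz factor 1/2 of \<open>h\<close> is the contraction
  factor. The value of \<open>h\<close> at 0 and its Lipschitz part each contribute
  \<open>K * exp (- Re w)\<close>, whence the radius \<open>2 * K * exp (- Re w)\<close>; the
  condition \<open>2 * K * exp (- R) \<le> 1\<close> keeps this ball inside the unit polydisc on
  which \<open>h\<close> is controlled. The Lipschitz hypothesis is pointwise in \<open>w\<close>,
  so that \<open>d\<close> may decay with \<open>w\<close>.\<close>

theorem semilinear_ode_solution:
  fixes h :: "'i \<Rightarrow> complex \<Rightarrow> ('i \<Rightarrow> complex) \<Rightarrow> complex" and \<mu> :: "'i \<Rightarrow> complex" and A B R :: real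
  defines "H \<equiv> halfstrip A B R"
  assumes hol: "\<And>i f. (\<And>j. f j holomorphic_on H) \<Longrightarrow> (\<And>j w. w \<in> H \<Longrightarrow> norm (f j w) \<le> 1)
      \<Longrightarrow> (\<lambda>w. h i w (\<lambda>j. f j w)) holomorphic_on H"
    and lip: "\<And>i w f g d. w \<in> H \<Longrightarrow> (\<And>j. norm (f j) \<le> 1) \<Longrightarrow> (\<And>j. norm (g j) \<le> 1)
      \<Longrightarrow> (\<And>j. norm (f j - g j) \<le> d) \<Longrightarrow> norm (h i w f - h i w g) \<le> d / 2"
    and zero: "\<And>i w. w \<in> H \<Longrightarrow> norm (h i w (\<lambda>_. 0)) \<le> K * exp (- Re w)"
    and K: "0 \<le> K" "2 * K * exp (- R) \<le> 1"
    and \<mu>: "\<And>i. Re (\<mu> i) \<ge> 0"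
  obtains f where
    "\<And>i w. w \<in> H \<Longrightarrow> (f i has_field_derivative \<mu> i * f i w + h i w (\<lambda>j. f j w)) (at w)"
    "\<And>i w. w \<in> H \<Longrightarrow> norm (f i w) \<le> 2 * K * exp (- Re w)"
    "\<And>i w. w \<in> H \<Longrightarrow> norm (f i w) \<le> 1"
proof -
  note openH = open_halfstrip[of A B R, folded H_def]
  have small: "2 * K * exp (- Re w) \<le> 1" if "w \<in> H" for w
  proof -
    have "2 * K * exp (- Re w) \<le> 2 * K * exp (- R)"
      using that K(1) by (intro mult_left_mono) (auto simp: H_def halfstrip_def)
    then show ?thesis using K(2) by linarith
  qed
  define good where "good f \<longleftrightarrow> (\<forall>i. f i holomorphic_on H) \<and> (\<forall>i. \<forall>w\<in>H. norm (f i w) \<le> 2 * K * exp (- Re w))"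
    for f :: "'i \<Rightarrow> complex \<Rightarrow> complex"
  have good1: "norm (f i w) \<le> 1" if "good f" "w \<in> H" for f i w
    using that small[OF that(2)] unfolding good_def by (meson order_trans)
  define step where "step f g \<longleftrightarrow> good g \<and>
      (\<forall>i. \<forall>w\<in>H. (g i has_field_derivative \<mu> i * g i w + h i w (\<lambda>j. f j w)) (at w))" for f g
  have ex_step: "\<exists>g. step f g" if f: "good f" for f
  proof -
    have "\<exists>g. \<forall>w\<in>H. (g has_field_derivative \<mu> i * g w + h i w (\<lambda>j. f j w)) (at w) \<and> norm (g w) \<le> 2 * K * exp (- Re w)" for i
    proof -
      have h1: "(\<lambda>w. h i w (\<lambda>j. f j w)) holomorphic_on halfstrip A B R"
        using hol[of f i] good1[OF f] f by (auto simp: good_def H_def)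
      have h2: "norm (h i w (\<lambda>j. f j w)) \<le> 2 * K * exp (- Re w)" if "w \<in> halfstrip A B R" for w
      proof -
        have w: "w \<in> H" using that by (simp add: H_def)
        have "norm (h i w (\<lambda>j. f j w) - h i w (\<lambda>_. 0)) \<le> (2 * K * exp (- Re w)) / 2"
          using f good1[OF f w] w by (intro lip) (auto simp: good_def)
        then have "norm (h i w (\<lambda>j. f j w)) \<le> norm (h i w (\<lambda>_. 0)) + K * exp (- Re w)"
          using norm_triangle_sub[of "h i w (\<lambda>j. f j w)" "h i w (\<lambda>_. 0)"] by simp
        then show ?thesis using zero[OF w, of i] by linarith
      qed
      show ?thesis
        by (rule linear_ode_solution[OF h1 h2 \<mu>[of i]]) (auto simp: H_def)
    qed
    then obtain g where g: "\<And>i w. w \<in> H \<Longrightarrow> (g i has_field_derivative \<mu> i * g i w + h i w (\<lambda>j. f j w)) (at w)"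
        "\<And>i w. w \<in> H \<Longrightarrow> norm (g i w) \<le> 2 * K * exp (- Re w)"
      by metis
    have "g i holomorphic_on H" for i
      using g(1) by (auto simp: holomorphic_on_open[OF openH])
    then have "step f g" using g by (auto simp: step_def good_def)
    then show ?thesis by blast
  qed
  \<comment> \<open>Each iterate is some chosen solution of the linear equation. Membership in
    \<open>good\<close> makes it vanish at infinity, which is what \<open>linear_ode_decay\<close>
    asks of the differences.\<close>
  define F where "F = rec_nat (\<lambda>i w. 0) (\<lambda>n f. SOME g. step f g)"
  have F0: "F 0 = (\<lambda>i w. 0)" and FS: "F (Suc n) = (SOME g. step (F n) g)" for n
    by (simp_all add: F_def)
  have goodF: "good (F n)" for n
  proof (induction n)
    case 0
    show ?case using K(1) by (auto simp: F0 good_def)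
  next
    case (Suc n)
    from someI_ex[OF ex_step[OF Suc]] show ?case by (simp add: FS step_def)
  qed
  have stepF: "step (F n) (F (Suc n))" for n
    unfolding FS by (rule someI_ex[OF ex_step[OF goodF]])
  have incr: "\<forall>i. \<forall>w\<in>H. norm (F (Suc n) i w - F n i w) \<le> 2 * K * (1 / 2) ^ n * exp (- Re w)" for n
  proof (induction n)
    case 0
    show ?case using goodF[of "Suc 0"] by (auto simp: F0 good_def)
  next
    case (Suc n)
    show ?case
    proof (intro allI ballI)
      fix i w assume w: "w \<in> H"
      have ws: "w + of_real s \<in> H" if "0 \<le> s" for s
        using halfstrip_add_real w that by (simp add: H_def)
      have "norm ((\<lambda>w. F (Suc (Suc n)) i w - F (Suc n) i w) w) \<le> (K * (1 / 2) ^ n) * exp (- Re w)"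
      proof (rule linear_ode_decay[where \<mu> = "\<mu> i" and e = "\<lambda>w. h i w (\<lambda>j. F (Suc n) j w) - h i w (\<lambda>j. F n j w)"])
        fix s :: real assume s: "0 \<le> s"
        let ?w = "w + of_real s"
        have "((\<lambda>w. F (Suc (Suc n)) i w - F (Suc n) i w) has_field_derivative
          (\<mu> i * F (Suc (Suc n)) i ?w + h i ?w (\<lambda>j. F (Suc n) j ?w)) - (\<mu> i * F (Suc n) i ?w + h i ?w (\<lambda>j. F n j ?w))) (at ?w)"
          using stepF[of "Suc n"] stepF[of n] ws[OF s] unfolding step_def by (intro DERIV_diff) auto
        then show "((\<lambda>w. F (Suc (Suc n)) i w - F (Suc n) i w) has_field_derivative
          \<mu> i * (F (Suc (Suc n)) i ?w - F (Suc n) i ?w) + (h i ?w (\<lambda>j. F (Suc n) j ?w) - h i ?w (\<lambda>j. F n j ?w))) (at ?w)"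
          by (simp add: algebra_simps)
        have "norm (h i ?w (\<lambda>j. F (Suc n) j ?w) - h i ?w (\<lambda>j. F n j ?w)) \<le> (2 * K * (1 / 2) ^ n * exp (- Re ?w)) / 2"
          by (intro lip) (use Suc ws[OF s] good1[OF goodF] in blast)+
        then show "norm (h i ?w (\<lambda>j. F (Suc n) j ?w) - h i ?w (\<lambda>j. F n j ?w)) \<le> K * (1 / 2) ^ n * exp (- Re w - s)"
          by simp
      next
        show "Re (\<mu> i) \<ge> 0" by (rule \<mu>)
        have "((\<lambda>s. 4 * K * exp (- Re w - s)) \<longlongrightarrow> 4 * K * 0) at_top"
          by (intro tendsto_intros exp_neg_real_tendsto_0)
        then show "((\<lambda>s. F (Suc (Suc n)) i (w + of_real s) - F (Suc n) i (w + of_real s)) \<longlongrightarrow> 0) at_top"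
        proof (rule Lim_null_comparison[rotated, OF tendsto_eq_rhs])
          show "\<forall>\<^sub>F s in at_top. norm (F (Suc (Suc n)) i (w + of_real s) - F (Suc n) i (w + of_real s)) \<le> 4 * K * exp (- Re w - s)"
            using eventually_ge_at_top[of 0]
          proof eventually_elim
            case (elim s)
            have "norm (F m i (w + of_real s)) \<le> 2 * K * exp (- Re w - s)" for m
              using goodF[of m] ws[OF elim] by (force simp: good_def)
            from this[of "Suc (Suc n)"] this[of "Suc n"] show ?case
              using norm_triangle_ineq4[of "F (Suc (Suc n)) i (w + of_real s)" "F (Suc n) i (w + of_real s)"] by linarith
          qed
        qed simp
      qed
      then show "norm (F (Suc (Suc n)) i w - F (Suc n) i w) \<le> 2 * K * (1 / 2) ^ (Suc n) * exp (- Re w)"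
        by simp
    qed
  qed
  define f where "f i w = (\<Sum>n. F (Suc n) i w - F n i w)" for i w
  have Fsum: "(\<Sum>k<n. F (Suc k) i w - F k i w) = F n i w" for n i w
    by (induction n) (auto simp: F0)
  have unif: "uniform_limit H (\<lambda>n w. F n i w) (f i) sequentially" for i
  proof -
    have "uniform_limit H (\<lambda>n w. \<Sum>k<n. F (Suc k) i w - F k i w) (\<lambda>w. \<Sum>k. F (Suc k) i w - F k i w) sequentially"
    proof (rule Weierstrass_m_test)
      show "norm (F (Suc n) i w - F n i w) \<le> (1 / 2) ^ n" if "w \<in> H" for n w
      proof -
        have "norm (F (Suc n) i w - F n i w) \<le> (2 * K * exp (- Re w)) * (1 / 2) ^ n"
          using incr[of n] that by (simp add: algebra_simps)
        also have "\<dots> \<le> 1 * (1 / 2) ^ n"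
          using small[OF that] by (intro mult_right_mono) auto
        finally show ?thesis by simp
      qed
      show "summable (\<lambda>n. (1 / 2 :: real) ^ n)" by (simp add: summable_geometric)
    qed
    then show ?thesis unfolding Fsum f_def .
  qed
  have lim: "(\<lambda>n. F n i w) \<longlonglongrightarrow> f i w" if "w \<in> H" for i w
    by (rule tendsto_uniform_limitI[OF unif that])
  have fb: "norm (f i w) \<le> 2 * K * exp (- Re w)" if "w \<in> H" for i w
    by (rule tendsto_upperbound[OF tendsto_norm[OF lim[OF that]]])
      (use goodF that in \<open>auto simp: good_def\<close>)
  have f1: "norm (f i w) \<le> 1" if "w \<in> H" for i w
    using fb[OF that, of i] small[OF that] by linarith
  have der: "(f i has_field_derivative \<mu> i * f i w + h i w (\<lambda>j. f j w)) (at w)" if w: "w \<in> H" for i w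
  proof -
    \<comment> \<open>The derivatives of the iterates converge by the uniform limit theorem for
      holomorphic functions; Lipschitz continuity of \<open>h\<close> then identifies their limit
      with the right-hand side.\<close>
    define F' where "F' n w = \<mu> i * F (Suc n) i w + h i w (\<lambda>j. F n j w)" for n w
    have "\<exists>g'. \<forall>x\<in>H. (f i has_field_derivative g' x) (at x) \<and> ((\<lambda>n. F' n x) \<longlonglongrightarrow> g' x)"
    proof (rule has_complex_derivative_uniform_sequence[OF openH])
      show "(F (Suc n) i has_field_derivative F' n x) (at x)" if "x \<in> H" for n x
        using stepF[of n] that by (auto simp: step_def F'_def)
      fix x assume "x \<in> H"
      then obtain d where d: "0 < d" "cball x d \<subseteq> H"
        using openH open_contains_cball by blast
      have "uniform_limit H (\<lambda>n w. F (Suc n) i w) (f i) sequentially"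
        using unif[of i] filterlim_sequentially_Suc[of "\<lambda>n w. F n i w"] by (simp add: filterlim_sequentially_Suc)
      with d show "\<exists>d>0. cball x d \<subseteq> H \<and> uniform_limit (cball x d) (\<lambda>n. F (Suc n) i) (f i) sequentially"
        by (blast intro: uniform_limit_on_subset)
    qed
    then obtain g' where g': "(f i has_field_derivative g' w) (at w)" "(\<lambda>n. F' n w) \<longlonglongrightarrow> g' w"
      using w by blast
    have "(\<lambda>n. h i w (\<lambda>j. F n j w)) \<longlonglongrightarrow> h i w (\<lambda>j. f j w)"
    proof (rule tendstoI)
      fix e :: real assume "e > 0"
      have "\<forall>\<^sub>F n in sequentially. 4 * K * (1 / 2) ^ n * exp (- Re w) < e"
      proof (rule order_tendstoD(2))
        show "(\<lambda>n. 4 * K * (1 / 2) ^ n * exp (- Re w)) \<longlonglongrightarrow> 4 * K * 0 * exp (- Re w)"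
          by (intro tendsto_intros LIMSEQ_power_zero) auto
      qed (use \<open>e > 0\<close> in simp)
      then show "\<forall>\<^sub>F n in sequentially. dist (h i w (\<lambda>j. F n j w)) (h i w (\<lambda>j. f j w)) < e"
      proof eventually_elim
        case (elim n)
        \<comment> \<open>Tail of a geometric series: the sum of \<open>2 * K * (1 / 2) ^ k\<close>
          over \<open>k \<ge> n\<close> is \<open>4 * K * (1 / 2) ^ n\<close>.\<close>
        have "norm (F n j w - f j w) \<le> 4 * K * (1 / 2) ^ n * exp (- Re w)" for j
        proof -
          have *: "norm (F (n + m) j w - F n j w) \<le> 4 * K * (1 / 2) ^ n * exp (- Re w) * (1 - (1 / 2) ^ m)" for m
          proof (induction m)
            case (Suc m)
            have "norm (F (n + Suc m) j w - F n j w) \<le> norm (F (Suc (n + m)) j w - F (n + m) j w) + norm (F (n + m) j w - F n j w)"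
              using norm_triangle_ineq[of "F (Suc (n + m)) j w - F (n + m) j w" "F (n + m) j w - F n j w"] by simp
            also have "\<dots> \<le> 2 * K * (1 / 2) ^ (n + m) * exp (- Re w) + 4 * K * (1 / 2) ^ n * exp (- Re w) * (1 - (1 / 2) ^ m)"
              using incr[of "n + m"] w Suc by (intro add_mono) auto
            also have "\<dots> = 4 * K * (1 / 2) ^ n * exp (- Re w) * (1 - (1 / 2) ^ Suc m)"
              by (simp add: power_add algebra_simps)
            finally show ?case .
          qed simp
          have "norm (F (n + m) j w - F n j w) \<le> 4 * K * (1 / 2) ^ n * exp (- Re w)" for m
            using * [of m] K(1) mult_left_mono[of "1 - (1 / 2) ^ m" 1 "4 * K * (1 / 2) ^ n * exp (- Re w)"] by auto
          moreover have "(\<lambda>m. norm (F (n + m) j w - F n j w)) \<longlonglongrightarrow> norm (f j w - F n j w)"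
            using LIMSEQ_ignore_initial_segment[OF lim[OF w, of j], of n]
            by (intro tendsto_intros) (simp add: add.commute)
          ultimately have "norm (f j w - F n j w) \<le> 4 * K * (1 / 2) ^ n * exp (- Re w)"
            by (intro tendsto_upperbound[of _ _ sequentially]) auto
          then show ?thesis by (simp add: norm_minus_commute)
        qed
        then have "norm (h i w (\<lambda>j. F n j w) - h i w (\<lambda>j. f j w)) \<le> (4 * K * (1 / 2) ^ n * exp (- Re w)) / 2"
          by (intro lip) (use w f1 good1[OF goodF] in blast)+
        moreover have "0 \<le> norm (h i w (\<lambda>j. F n j w) - h i w (\<lambda>j. f j w))" by simp
        ultimately show ?case using elim unfolding dist_norm by linarith
      qed
    qed
    moreover have "(\<lambda>n. F (Suc n) i w) \<longlonglongrightarrow> f i w"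
      by (rule LIMSEQ_Suc[OF lim[OF w]])
    ultimately have "(\<lambda>n. F' n w) \<longlonglongrightarrow> \<mu> i * f i w + h i w (\<lambda>j. f j w)"
      unfolding F'_def by (intro tendsto_intros)
    with g'(2) have "g' w = \<mu> i * f i w + h i w (\<lambda>j. f j w)"
      by (rule LIMSEQ_unique)
    with g'(1) show ?thesis by simp
  qed
  show ?thesis using that der fb f1 by blast
qed

text \<open>Boundedness, Lipschitz continuity and holomorphy on the unit polydisc, uniformly in the
  parameter, in a form that is closed under the field operations.\<close>

definition tame :: "complex set \<Rightarrow> (complex \<Rightarrow> ('i \<Rightarrow> complex) \<Rightarrow> complex) \<Rightarrow> bool" where
  "tame H \<phi> \<longleftrightarrow>
    (\<exists>K\<ge>0. \<forall>w\<in>H. \<forall>f g d. (\<forall>j. norm (f j) \<le> 1) \<longrightarrow> (\<forall>j. norm (g j) \<le> 1) \<longrightarrow> (\<forall>j. norm (f j - g j) \<le> d) \<longrightarrow>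
       norm (\<phi> w f) \<le> K \<and> norm (\<phi> w f - \<phi> w g) \<le> K * d) \<and>
    (\<forall>H'\<subseteq>H. \<forall>f. (\<forall>j. f j holomorphic_on H') \<longrightarrow> (\<forall>j. \<forall>w\<in>H'. norm (f j w) \<le> 1) \<longrightarrow>
       (\<lambda>w. \<phi> w (\<lambda>j. f j w)) holomorphic_on H')"

lemma tame_holomorphic:
  assumes "tame H \<phi>" "H' \<subseteq> H" "\<And>j. f j holomorphic_on H'" "\<And>j w. w \<in> H' \<Longrightarrow> norm (f j w) \<le> 1"
  shows "(\<lambda>w. \<phi> w (\<lambda>j. f j w)) holomorphic_on H'"
  using assms unfolding tame_def by blast

lemma tame_bound:
  fixes \<phi> :: "complex \<Rightarrow> ('i \<Rightarrow> complex) \<Rightarrow> complex"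
  assumes "tame H \<phi>"
  obtains K where "0 \<le> K"
    "\<And>w f. w \<in> H \<Longrightarrow> (\<And>j. norm (f j) \<le> 1) \<Longrightarrow> norm (\<phi> w f) \<le> K"
    "\<And>w f g d. w \<in> H \<Longrightarrow> (\<And>j. norm (f j) \<le> 1) \<Longrightarrow> (\<And>j. norm (g j) \<le> 1) \<Longrightarrow> (\<And>j. norm (f j - g j) \<le> d)
      \<Longrightarrow> norm (\<phi> w f - \<phi> w g) \<le> K * d"
proof -
  obtain K where K: "0 \<le> K" "\<forall>w\<in>H. \<forall>f g d. (\<forall>j. norm (f j) \<le> 1) \<longrightarrow> (\<forall>j. norm (g j) \<le> 1) \<longrightarrow> (\<forall>j. norm (f j - g j) \<le> d) \<longrightarrow>
       norm (\<phi> w f) \<le> K \<and> norm (\<phi> w f - \<phi> w g) \<le> K * d"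
    using assms unfolding tame_def by blast
  show thesis
  proof (rule that[OF K(1)])
    fix w and f :: "'i \<Rightarrow> complex" assume "w \<in> H" "\<And>j. norm (f j) \<le> 1"
    then show "norm (\<phi> w f) \<le> K" using K(2)[rule_format, of w f f 0] by simp
  next
    fix w d and f g :: "'i \<Rightarrow> complex"
    assume "w \<in> H" "\<And>j. norm (f j) \<le> 1" "\<And>j. norm (g j) \<le> 1" "\<And>j. norm (f j - g j) \<le> d"
    then show "norm (\<phi> w f - \<phi> w g) \<le> K * d" using K(2)[rule_format, of w f g d] by blast
  qed
qed

text \<open>Size and Lipschitz bound may come with separate constants; \<open>d\<close> is
  nonnegative as a bound of norms, so the maximum serves for both.\<close>

lemma tameI:
  fixes \<phi> :: "complex \<Rightarrow> ('i \<Rightarrow> complex) \<Rightarrow> complex"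
  assumes "0 \<le> K"
    and "\<And>w f. w \<in> H \<Longrightarrow> (\<And>j. norm (f j) \<le> 1) \<Longrightarrow> norm (\<phi> w f) \<le> K"
    and "\<And>w f g d. w \<in> H \<Longrightarrow> (\<And>j. norm (f j) \<le> 1) \<Longrightarrow> (\<And>j. norm (g j) \<le> 1) \<Longrightarrow> (\<And>j. norm (f j - g j) \<le> d)
      \<Longrightarrow> norm (\<phi> w f - \<phi> w g) \<le> L * d"
    and "\<And>H' f. H' \<subseteq> H \<Longrightarrow> (\<And>j. f j holomorphic_on H') \<Longrightarrow> (\<And>j w. w \<in> H' \<Longrightarrow> norm (f j w) \<le> 1)
      \<Longrightarrow> (\<lambda>w. \<phi> w (\<lambda>j. f j w)) holomorphic_on H'"
  shows "tame H \<phi>"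
  unfolding tame_def
proof (intro conjI exI[of _ "max K L"] ballI allI impI)
  show "0 \<le> max K L" using assms(1) by simp
next
  fix w and f g :: "'i \<Rightarrow> complex" and d
  assume a: "w \<in> H" "\<forall>j. norm (f j) \<le> 1" "\<forall>j. norm (g j) \<le> 1" "\<forall>j. norm (f j - g j) \<le> d"
  then show "norm (\<phi> w f) \<le> max K L" using assms(2)[of w f] by auto
  have "0 \<le> d" using a(4) norm_ge_zero order_trans by blast
  then have "L * d \<le> max K L * d" by (intro mult_right_mono) auto
  then show "norm (\<phi> w f - \<phi> w g) \<le> max K L * d" using assms(3)[of w f g d] a by auto
next
  fix H' and f :: "'i \<Rightarrow> complex \<Rightarrow> complex"
  assume "H' \<subseteq> H" "\<forall>j. f j holomorphic_on H'" "\<forall>j. \<forall>w\<in>H'. norm (f j w) \<le> 1"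
  then show "(\<lambda>w. \<phi> w (\<lambda>j. f j w)) holomorphic_on H'" using assms(4) by blast
qed

lemma tame_param:
  fixes c :: "complex \<Rightarrow> complex"
  assumes "c holomorphic_on H" "\<And>w. w \<in> H \<Longrightarrow> norm (c w) \<le> K"
  shows "tame H (\<lambda>w f. c w)"
  by (rule tameI[of "max 0 K" _ _ 0]) (use assms in \<open>auto intro: holomorphic_on_subset simp: le_max_iff_disj\<close>)

lemma tame_const: "tame H (\<lambda>w f. c)"
  by (rule tame_param[of _ _ "norm c"]) auto

lemma tame_proj: "tame H (\<lambda>w f. f j)"
  by (rule tameI[of 1 _ _ 1]) auto

lemma tame_add:
  fixes \<phi> \<psi> :: "complex \<Rightarrow> ('i \<Rightarrow> complex) \<Rightarrow> complex"
  assumes "tame H \<phi>" "tame H \<psi>"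
  shows "tame H (\<lambda>w f. \<phi> w f + \<psi> w f)"
proof -
  obtain K where K: "0 \<le> K"
    "\<And>w f. w \<in> H \<Longrightarrow> (\<And>j. norm (f j) \<le> 1) \<Longrightarrow> norm (\<phi> w f) \<le> K"
    "\<And>w f g d. w \<in> H \<Longrightarrow> (\<And>j. norm (f j) \<le> 1) \<Longrightarrow> (\<And>j. norm (g j) \<le> 1) \<Longrightarrow> (\<And>j. norm (f j - g j) \<le> d)
      \<Longrightarrow> norm (\<phi> w f - \<phi> w g) \<le> K * d"
    by (rule tame_bound[OF assms(1)]) blast
  obtain L where L: "0 \<le> L"
    "\<And>w f. w \<in> H \<Longrightarrow> (\<And>j. norm (f j) \<le> 1) \<Longrightarrow> norm (\<psi> w f) \<le> L"
    "\<And>w f g d. w \<in> H \<Longrightarrow> (\<And>j. norm (f j) \<le> 1) \<Longrightarrow> (\<And>j. norm (g j) \<le> 1) \<Longrightarrow> (\<And>j. norm (f j - g j) \<le> d)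
      \<Longrightarrow> norm (\<psi> w f - \<psi> w g) \<le> L * d"
    by (rule tame_bound[OF assms(2)]) blast
  show ?thesis
  proof (rule tameI[of "K + L" _ _ "K + L"])
    fix w d and f g :: "'i \<Rightarrow> complex"
    assume *: "w \<in> H" "\<And>j. norm (f j) \<le> 1" "\<And>j. norm (g j) \<le> 1" "\<And>j. norm (f j - g j) \<le> d"
    have "norm (\<phi> w f + \<psi> w f - (\<phi> w g + \<psi> w g)) \<le> norm (\<phi> w f - \<phi> w g) + norm (\<psi> w f - \<psi> w g)"
      unfolding add_diff_add by (rule norm_triangle_ineq)
    also have "\<dots> \<le> K * d + L * d" by (intro add_mono K L *)
    finally show "norm (\<phi> w f + \<psi> w f - (\<phi> w g + \<psi> w g)) \<le> (K + L) * d" by (simp add: algebra_simps)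
  qed (auto intro!: holomorphic_intros tame_holomorphic[OF assms(1)] tame_holomorphic[OF assms(2)] norm_triangle_mono K L add_nonneg_nonneg)
qed

lemma tame_mult:
  fixes \<phi> \<psi> :: "complex \<Rightarrow> ('i \<Rightarrow> complex) \<Rightarrow> complex"
  assumes "tame H \<phi>" "tame H \<psi>"
  shows "tame H (\<lambda>w f. \<phi> w f * \<psi> w f)"
proof -
  obtain K where K: "0 \<le> K"
    "\<And>w f. w \<in> H \<Longrightarrow> (\<And>j. norm (f j) \<le> 1) \<Longrightarrow> norm (\<phi> w f) \<le> K"
    "\<And>w f g d. w \<in> H \<Longrightarrow> (\<And>j. norm (f j) \<le> 1) \<Longrightarrow> (\<And>j. norm (g j) \<le> 1) \<Longrightarrow> (\<And>j. norm (f j - g j) \<le> d)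
      \<Longrightarrow> norm (\<phi> w f - \<phi> w g) \<le> K * d"
    by (rule tame_bound[OF assms(1)]) blast
  obtain L where L: "0 \<le> L"
    "\<And>w f. w \<in> H \<Longrightarrow> (\<And>j. norm (f j) \<le> 1) \<Longrightarrow> norm (\<psi> w f) \<le> L"
    "\<And>w f g d. w \<in> H \<Longrightarrow> (\<And>j. norm (f j) \<le> 1) \<Longrightarrow> (\<And>j. norm (g j) \<le> 1) \<Longrightarrow> (\<And>j. norm (f j - g j) \<le> d)
      \<Longrightarrow> norm (\<psi> w f - \<psi> w g) \<le> L * d"
    by (rule tame_bound[OF assms(2)]) blast
  show ?thesis
  proof (rule tameI[of "K * L" _ _ "2 * K * L"])
    fix w d and f g :: "'i \<Rightarrow> complex"
    assume *: "w \<in> H" "\<And>j. norm (f j) \<le> 1" "\<And>j. norm (g j) \<le> 1" "\<And>j. norm (f j - g j) \<le> d"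
    have "0 \<le> d" using *(4) norm_ge_zero order_trans by blast
    have "norm (\<phi> w f * \<psi> w f - \<phi> w g * \<psi> w g) = norm (\<phi> w f * (\<psi> w f - \<psi> w g) + (\<phi> w f - \<phi> w g) * \<psi> w g)"
      by (simp add: algebra_simps)
    also have "\<dots> \<le> norm (\<phi> w f) * norm (\<psi> w f - \<psi> w g) + norm (\<phi> w f - \<phi> w g) * norm (\<psi> w g)"
      by (rule order_trans[OF norm_triangle_ineq]) (simp add: norm_mult)
    also have "\<dots> \<le> K * (L * d) + (K * d) * L"
      using \<open>0 \<le> d\<close> by (intro add_mono mult_mono K L * mult_nonneg_nonneg norm_ge_zero)
    finally show "norm (\<phi> w f * \<psi> w f - \<phi> w g * \<psi> w g) \<le> 2 * K * L * d" by (simp add: algebra_simps)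
  next
    fix w and f :: "'i \<Rightarrow> complex" assume "w \<in> H" "\<And>j. norm (f j) \<le> 1"
    then show "norm (\<phi> w f * \<psi> w f) \<le> K * L" unfolding norm_mult by (intro mult_mono K L norm_ge_zero)
  qed (auto intro!: holomorphic_intros tame_holomorphic[OF assms(1)] tame_holomorphic[OF assms(2)] mult_nonneg_nonneg K L)
qed

lemma tame_minus: "tame H \<phi> \<Longrightarrow> tame H (\<lambda>w f. - \<phi> w f)"
  using tame_mult[OF tame_const[of H "-1"], of \<phi>] by simp

lemma tame_diff: "tame H \<phi> \<Longrightarrow> tame H \<psi> \<Longrightarrow> tame H (\<lambda>w f. \<phi> w f - \<psi> w f)"
  using tame_add[OF _ tame_minus, of H \<phi> \<psi>] by simp

lemma tame_power2: "tame H \<phi> \<Longrightarrow> tame H (\<lambda>w f. (\<phi> w f)\<^sup>2)"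
  unfolding power2_eq_square by (rule tame_mult)

text \<open>Lipschitz continuity comes from \<open>1/a - 1/b = (b - a) / (a b)\<close>, which is why
  the lower bound has to be uniform in \<open>w\<close> and on the polydisc.\<close>

lemma tame_inverse:
  fixes \<phi> :: "complex \<Rightarrow> ('i \<Rightarrow> complex) \<Rightarrow> complex"
  assumes "tame H \<phi>" "0 < \<delta>" and lower: "\<And>w f. w \<in> H \<Longrightarrow> (\<And>j. norm (f j) \<le> 1) \<Longrightarrow> \<delta> \<le> norm (\<phi> w f)"
  shows "tame H (\<lambda>w f. inverse (\<phi> w f))"
proof -
  obtain K where K: "0 \<le> K"
    "\<And>w f. w \<in> H \<Longrightarrow> (\<And>j. norm (f j) \<le> 1) \<Longrightarrow> norm (\<phi> w f) \<le> K"
    "\<And>w f g d. w \<in> H \<Longrightarrow> (\<And>j. norm (f j) \<le> 1) \<Longrightarrow> (\<And>j. norm (g j) \<le> 1) \<Longrightarrow> (\<And>j. norm (f j - g j) \<le> d)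
      \<Longrightarrow> norm (\<phi> w f - \<phi> w g) \<le> K * d"
    by (rule tame_bound[OF assms(1)]) blast
  have inv: "norm (inverse (\<phi> w f)) \<le> inverse \<delta>" if "w \<in> H" "\<And>j. norm (f j) \<le> 1" for w f
    unfolding norm_inverse using lower[OF that] \<open>0 < \<delta>\<close> by (intro le_imp_inverse_le) auto
  have nz: "\<phi> w f \<noteq> 0" if "w \<in> H" "\<And>j. norm (f j) \<le> 1" for w f
    using lower[of w f, OF that] \<open>0 < \<delta>\<close> by force
  show ?thesis
  proof (rule tameI[of "inverse \<delta>" _ _ "inverse \<delta> * K * inverse \<delta>"])
    fix w d and f g :: "'i \<Rightarrow> complex"
    assume *: "w \<in> H" "\<And>j. norm (f j) \<le> 1" "\<And>j. norm (g j) \<le> 1" "\<And>j. norm (f j - g j) \<le> d"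
    have "0 \<le> d" using *(4) norm_ge_zero order_trans by blast
    have "inverse (\<phi> w f) - inverse (\<phi> w g) = - (inverse (\<phi> w f) * (\<phi> w f - \<phi> w g) * inverse (\<phi> w g))"
      by (intro inverse_diff_inverse nz *)
    then have "norm (inverse (\<phi> w f) - inverse (\<phi> w g)) = norm (inverse (\<phi> w f)) * norm (\<phi> w f - \<phi> w g) * norm (inverse (\<phi> w g))"
      by (simp add: norm_mult)
    also have "\<dots> \<le> inverse \<delta> * (K * d) * inverse \<delta>"
      using \<open>0 \<le> d\<close> \<open>0 < \<delta>\<close> by (intro mult_mono inv K * mult_nonneg_nonneg norm_ge_zero) auto
    finally show "norm (inverse (\<phi> w f) - inverse (\<phi> w g)) \<le> inverse \<delta> * K * inverse \<delta> * d" by (simp add: algebra_simps)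
  next
    fix H' and f :: "'i \<Rightarrow> complex \<Rightarrow> complex"
    assume *: "H' \<subseteq> H" "\<And>j. f j holomorphic_on H'" "\<And>j w. w \<in> H' \<Longrightarrow> norm (f j w) \<le> 1"
    show "(\<lambda>w. inverse (\<phi> w (\<lambda>j. f j w))) holomorphic_on H'"
    proof (rule holomorphic_on_inverse)
      show "(\<lambda>w. \<phi> w (\<lambda>j. f j w)) holomorphic_on H'"
        by (rule tame_holomorphic[OF assms(1) *])
      show "\<phi> w (\<lambda>j. f j w) \<noteq> 0" if "w \<in> H'" for w
        by (rule nz) (use * that in blast)+
    qed
  qed (use \<open>0 < \<delta>\<close> inv in auto)
qed

lemmas tame_intros = tame_const tame_proj tame_add tame_diff tame_minus tame_mult tame_power2


subsection \<open>The third-order equation as a first-order system\<close>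

text \<open>Names of the three triangular coordinates: \<open>CY\<close> for \<open>Y\<close>,
  \<open>CM\<close> for the mode with eigenvalue \<open>4 \<nu>\<close>, \<open>CN\<close> for the
  neutral mode.\<close>

datatype comp = CY | CM | CN

locale painleve =
  fixes \<nu> \<nu>3 \<nu>4 C :: complex
  assumes Re_\<nu>: "Re \<nu> > 0"
begin

lemma \<nu>_nz: "\<nu> \<noteq> 0"
  using Re_\<nu> by auto

text \<open>Constant term of the asymptotics. With this value
  \<open>2 u' (t u' - u) - u'^2 - \<nu>^2 \<nu>3 \<nu>4\<close> has no constant term in
  \<open>p\<close> and \<open>z\<close>, so the origin satisfies the equation.\<close>

definition "a = (\<nu>\<^sup>2 + \<nu>3 * \<nu>4) / 2"
definition "b = \<nu>\<^sup>2 - \<nu>3 * \<nu>4"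
text \<open>With \<open>\<alpha>\<close> and \<open>\<beta>\<close> the right side of the equation
  becomes \<open>p^2 (p - \<alpha>) (p - \<beta>)\<close>.\<close>

definition "\<alpha> = \<nu>\<^sup>2 - \<nu>3\<^sup>2"
definition "\<beta> = \<nu>\<^sup>2 - \<nu>4\<^sup>2"

definition den :: "complex \<Rightarrow> complex \<Rightarrow> complex" where
  "den x p = 2 * (1 - x) * (p - \<nu>\<^sup>2)"

text \<open>The expression that is squared in the equation, rewritten by means of
  \<open>t u' - u = z - a\<close>.\<close>

definition quad :: "complex \<Rightarrow> complex \<Rightarrow> complex" where
  "quad p z = 2 * (p - \<nu>\<^sup>2) * z + b * p - p\<^sup>2"

text \<open>The third-order equation, multiplied by \<open>x\<close>, with \<open>p = u' + \<nu>\<^sup>2\<close> and \<open>v' = dv/dw\<close>.\<close>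

definition bracket :: "complex \<Rightarrow> complex \<Rightarrow> complex \<Rightarrow> complex \<Rightarrow> complex \<Rightarrow> complex" where
  "bracket x p z v v' = den x p * v' + x * v\<^sup>2 + 4 * quad p z * (x * (z - a) + (1 - x) * (p - \<nu>\<^sup>2))
     - x * (2 * p * (p - \<alpha>) * (p - \<beta>) + p\<^sup>2 * (2 * p - \<alpha> - \<beta>))"

text \<open>The third-order equation solved for \<open>v'\<close>, after removal of the linear part
  \<open>4 \<nu>^2 z\<close> and division by \<open>x q\<close>. The division is carried out by
  hand, so that \<open>x = 0\<close> causes no singularity and only \<open>den\<close> is left as a
  denominator.\<close>

definition G :: "complex \<Rightarrow> complex \<Rightarrow> complex \<Rightarrow> complex \<Rightarrow> complex \<Rightarrow> complex" where
  "G x q Y Z V = (let s = Y + Z; p = x * (q * s) in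
     - 4 * q * s * Z - 2 * b * s + 2 * x * q * s\<^sup>2 +
     (2 * x * s * (p - \<alpha>) * (p - \<beta>) + x * p * s * (2 * p - \<alpha> - \<beta>) - q * V\<^sup>2
       - 4 * (2 * (p - \<nu>\<^sup>2) * Z + b * x * s - x * p * s) * (q * Z - a)) * inverse (den x p))"

text \<open>Because \<open>p = x q s\<close>, all terms beyond the linear part have the factor
  \<open>x q\<close>. The product \<open>4 quad (1 - x) (p - \<nu>^2)\<close> equals
  \<open>2 den quad\<close>, hence contributes to \<open>v'\<close> without a quotient: it yields
  the linear term and the summand \<open>P\<close> of \<open>G\<close>, the rest yields
  \<open>N / den\<close>.\<close>

lemma bracket_eq_0_iff:
  assumes p: "p = x * (q * (Y + Z))" and "den x p \<noteq> 0"
  shows "bracket x p (q * Z) (q * V) v' = 0 \<longleftrightarrow> v' = 4 * \<nu>\<^sup>2 * (q * Z) + x * (q * G x q Y Z V)"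
proof -
  define s where "s = Y + Z"
  define N where "N = 2 * x * s * (p - \<alpha>) * (p - \<beta>) + x * p * s * (2 * p - \<alpha> - \<beta>) - q * V\<^sup>2
       - 4 * (2 * (p - \<nu>\<^sup>2) * Z + b * x * s - x * p * s) * (q * Z - a)"
  define P where "P = - 4 * q * s * Z - 2 * b * s + 2 * x * q * s\<^sup>2"
  have "G x q Y Z V = P + N * inverse (den x p)"
    unfolding G_def Let_def p s_def N_def P_def by simp
  then have dG: "den x p * G x q Y Z V = den x p * P + N"
    using assms(2) by (simp add: field_simps)
  have ps: "p = x * (q * s)" by (simp add: p s_def)
  define Q where "Q = 2 * (p - \<nu>\<^sup>2) * Z + b * x * s - x * p * s"
  define F where "F = 2 * x * s * (p - \<alpha>) * (p - \<beta>) + x * p * s * (2 * p - \<alpha> - \<beta>)"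
  have NQ: "N = F - q * V\<^sup>2 - 4 * Q * (q * Z - a)"
    by (simp add: N_def F_def Q_def)
  have p1: "p = q * (x * s)" and p2: "p\<^sup>2 = q * (x * p * s)"
    by (simp_all add: ps power2_eq_square)
  have "2 * p * (p - \<alpha>) * (p - \<beta>) = q * (2 * x * s * (p - \<alpha>) * (p - \<beta>))"
    by (subst (1) p1) simp
  then have F: "2 * p * (p - \<alpha>) * (p - \<beta>) + p\<^sup>2 * (2 * p - \<alpha> - \<beta>) = q * F"
    unfolding F_def p2 by (simp add: algebra_simps)
  have "b * p = q * (b * x * s)"
    by (subst p1) simp
  then have quad: "quad p (q * Z) = q * Q"
    unfolding quad_def Q_def p2 by (simp add: algebra_simps)
  have Q: "2 * Q = - (4 * \<nu>\<^sup>2 * Z) - x * P"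
    unfolding Q_def P_def by (simp add: ps algebra_simps power2_eq_square)
  have "bracket x p (q * Z) (q * V) v' = den x p * v' + q * (den x p * (2 * Q)) - x * (q * N)"
    unfolding bracket_def F quad NQ by (simp add: den_def algebra_simps power2_eq_square)
  also have "\<dots> = den x p * v' - den x p * (4 * \<nu>\<^sup>2 * (q * Z)) - x * (q * (den x p * P + N))"
    unfolding Q by (simp add: algebra_simps)
  also have "\<dots> = den x p * (v' - (4 * \<nu>\<^sup>2 * (q * Z) + x * (q * G x q Y Z V)))"
    unfolding dG[symmetric] by (simp add: algebra_simps)
  finally show ?thesis using assms(2) by simp
qed

text \<open>The coordinates \<open>\<nu> (Y - C)\<close>, \<open>V + 2\<nu> Z\<close> and \<open>V - 2\<nu> Z - N0\<close> vanish at infinity and put the linear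
  part in triangular form. For \<open>\<nu> = 1/2\<close> it has a Jordan block, so the coupling of the
  first coordinate to the other two cannot be removed; the factor \<open>\<nu>\<close> reduces its coefficients to
  \<open>\<plusminus>1/4\<close>, small enough for the contraction.\<close>

definition Yc :: "(comp \<Rightarrow> complex) \<Rightarrow> complex" where "Yc f = C + f CY * inverse \<nu>"
text \<open>The limit of \<open>V - 2 \<nu> Z\<close> at the neutral point with
  \<open>Y = C\<close>, where \<open>Z = - (1 + 2 \<nu>) C\<close> and
  \<open>V = - 2 \<nu> Z\<close>.\<close>

definition N0 :: complex where "N0 = 4 * \<nu> * (2 * \<nu> + 1) * C"
definition Zc :: "(comp \<Rightarrow> complex) \<Rightarrow> complex" where "Zc f = (f CM - (f CN + N0)) * inverse (4 * \<nu>)"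
definition Vc :: "(comp \<Rightarrow> complex) \<Rightarrow> complex" where "Vc f = (f CM + (f CN + N0)) * inverse 2"

text \<open>The last summand comes from \<open>V / (1 - x) = V + x V / (1 - x)\<close>: the first
  part belongs to the linear system, the second carries the factor \<open>x\<close> that is taken
  out here.\<close>

definition hM :: "complex \<Rightarrow> (comp \<Rightarrow> complex) \<Rightarrow> complex" where
  "hM w f = G (exp (- w)) (exp (- 2 * \<nu> * w)) (Yc f) (Zc f) (Vc f) + 2 * \<nu> * Vc f * inverse (1 - exp (- w))"
definition hN :: "complex \<Rightarrow> (comp \<Rightarrow> complex) \<Rightarrow> complex" where
  "hN w f = G (exp (- w)) (exp (- 2 * \<nu> * w)) (Yc f) (Zc f) (Vc f) - 2 * \<nu> * Vc f * inverse (1 - exp (- w))"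

definition rhs :: "comp \<Rightarrow> complex \<Rightarrow> (comp \<Rightarrow> complex) \<Rightarrow> complex" where
  "rhs i w f = (case i of CY \<Rightarrow> (f CM - f CN) * inverse 4 | CM \<Rightarrow> exp (- w) * hM w f | CN \<Rightarrow> exp (- w) * hN w f)"

definition ev :: "comp \<Rightarrow> complex" where
  "ev i = (case i of CY \<Rightarrow> 1 + 2 * \<nu> | CM \<Rightarrow> 4 * \<nu> | CN \<Rightarrow> 0)"

section \<open>Uniform bounds for the nonlinear terms\<close>

lemma norm_exp_power_le:
  assumes "w \<in> halfstrip A B 0"
  shows "norm (exp (- 2 * \<nu> * w)) \<le> exp (2 * \<bar>Im \<nu>\<bar> * (\<bar>A\<bar> + \<bar>B\<bar>))"
proof -
  \<comment> \<open>The modulus of \<open>q\<close> is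
    \<open>exp (- 2 (Re \<nu> Re w - Im \<nu> Im w))\<close>. The first product has the right sign,
    the second is bounded since the strip has finite width.\<close>
  have "0 \<le> Re \<nu> * Re w" using assms Re_\<nu> by (simp add: halfstrip_def)
  moreover have "Im \<nu> * Im w \<le> \<bar>Im \<nu>\<bar> * (\<bar>A\<bar> + \<bar>B\<bar>)"
  proof -
    have "Im \<nu> * Im w \<le> \<bar>Im \<nu>\<bar> * \<bar>Im w\<bar>"
      by (metis abs_ge_self abs_mult)
    also have "\<dots> \<le> \<bar>Im \<nu>\<bar> * (\<bar>A\<bar> + \<bar>B\<bar>)"
      using assms by (intro mult_left_mono) (auto simp: halfstrip_def)
    finally show ?thesis .
  qed
  ultimately show ?thesis by simp
qed

text \<open>For large \<open>R\<close> the quantities \<open>x\<close> and \<open>p\<close> are so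
  small that the denominators \<open>1 - x\<close> and \<open>den\<close> stay away from 0,
  uniformly on the polydisc; everything else is polynomial in bounded quantities.\<close>

lemma tame_h:
  obtains R where "0 \<le> R" "tame (halfstrip A B R) hM" "tame (halfstrip A B R) hN"
    "\<And>w f. w \<in> halfstrip A B R \<Longrightarrow> (\<And>j. norm (f j) \<le> 1) \<Longrightarrow>
        exp (- w) \<noteq> 1 \<and> den (exp (- w)) (exp (- w) * (exp (- 2 * \<nu> * w) * (Yc f + Zc f))) \<noteq> 0"
proof -
  have tx: "tame (halfstrip A B R) (\<lambda>w f. exp (- w))" if "0 \<le> R" for R
    by (rule tame_param[of _ _ 1]) (use that in \<open>auto intro!: holomorphic_intros simp: halfstrip_def\<close>)
  have tq: "tame (halfstrip A B R) (\<lambda>w f. exp (- 2 * \<nu> * w))" if "0 \<le> R" for R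
    using halfstrip_mono[OF that] by (intro tame_param[OF _ norm_exp_power_le] holomorphic_intros) auto
  have tY: "tame H (\<lambda>w f. Yc f)" "tame H (\<lambda>w f. Zc f)" "tame H (\<lambda>w f. Vc f)" for H
    unfolding Yc_def Zc_def Vc_def by (intro tame_intros)+
  let ?s = "\<lambda>w f. exp (- 2 * \<nu> * w) * (Yc f + Zc f)"
  have "tame (halfstrip A B 0) ?s" by (intro tame_intros tY tq) simp
  then obtain K where K: "0 \<le> K" "\<And>w f. w \<in> halfstrip A B 0 \<Longrightarrow> (\<And>j. norm (f j) \<le> 1) \<Longrightarrow> norm (?s w f) \<le> K"
    by (rule tame_bound) blast
  \<comment> \<open>\<open>ln 2\<close> gives \<open>|x| \<le> 1/2\<close>. The second entry gives
    \<open>|p| \<le> |\<nu>|^2 / 2\<close>, with \<open>K\<close> a bound for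
    \<open>q (Y + Z)\<close>; \<open>K + 1\<close> keeps the argument of \<open>ln\<close>
    positive.\<close>
  define R where "R = max (ln 2) (ln (2 * (K + 1) / norm \<nu> ^ 2))"
  have R0: "0 \<le> R" unfolding R_def by (simp add: le_max_iff_disj)
  define H where "H = halfstrip A B R"
  have x2: "norm (exp (- w)) \<le> 1 / 2" if "w \<in> H" for w
  proof -
    have "exp (- Re w) \<le> exp (- ln 2)" using that by (simp add: H_def halfstrip_def R_def)
    then show ?thesis by (simp add: exp_minus norm_inverse)
  qed
  have x1: "1 / 2 \<le> norm (1 - exp (- w))" if "w \<in> H" for w
    using x2[OF that] norm_triangle_ineq2[of 1 "exp (- w)"] by simp
  have p: "norm \<nu> ^ 2 / 2 \<le> norm (exp (- w) * ?s w f - \<nu>\<^sup>2)" if "w \<in> H" "\<And>j. norm (f j) \<le> 1" for w f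
  proof -
    have "exp (- Re w) \<le> exp (- ln (2 * (K + 1) / norm \<nu> ^ 2))"
      using that by (simp add: H_def halfstrip_def R_def)
    also have "\<dots> = norm \<nu> ^ 2 / (2 * (K + 1))"
      using K(1) \<nu>_nz by (simp add: exp_minus)
    finally have e: "norm (exp (- w)) \<le> norm \<nu> ^ 2 / (2 * (K + 1))" by simp
    have "norm (exp (- w) * ?s w f) \<le> norm \<nu> ^ 2 / (2 * (K + 1)) * (K + 1)"
      unfolding norm_mult[of "exp (- w)"] using halfstrip_mono[OF R0] that
      by (intro mult_mono e order_trans[OF K(2)]) (auto simp: H_def K(1))
    also have "\<dots> = norm \<nu> ^ 2 / 2"
      using K(1) by (simp add: field_simps)
    finally have "norm (exp (- w) * ?s w f) \<le> norm \<nu> ^ 2 / 2" .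
    then show ?thesis
      using norm_triangle_ineq2[of "\<nu>\<^sup>2" "exp (- w) * ?s w f"] by (simp add: norm_power norm_minus_commute)
  qed
  note t = tx[OF R0, folded H_def] tq[OF R0, folded H_def] tY
  have d: "norm \<nu> ^ 2 / 2 \<le> norm (den (exp (- w)) (exp (- w) * ?s w f))" if "w \<in> H" "\<And>j. norm (f j) \<le> 1" for w f
  proof -
    have "2 * (1 / 2) * (norm \<nu> ^ 2 / 2) \<le> 2 * norm (1 - exp (- w)) * norm (exp (- w) * ?s w f - \<nu>\<^sup>2)"
      using that by (intro mult_mono x1 p) auto
    then show ?thesis unfolding den_def norm_mult by simp
  qed
  have ti: "tame H (\<lambda>w f. inverse (den (exp (- w)) (exp (- w) * ?s w f)))"
  proof (rule tame_inverse[OF _ _ d])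
    show "tame H (\<lambda>w f. den (exp (- w)) (exp (- w) * ?s w f))"
      unfolding den_def by (intro tame_intros t)
  qed (use \<nu>_nz in auto)
  have t1: "tame H (\<lambda>w f. inverse (1 - exp (- w)))"
  proof (rule tame_inverse)
    show "tame H (\<lambda>w f. 1 - exp (- w))" by (intro tame_intros t)
    show "1 / 2 \<le> norm (1 - exp (- w))" if "w \<in> H" for w by (rule x1[OF that])
  qed simp
  have tG: "tame H (\<lambda>w f. G (exp (- w)) (exp (- 2 * \<nu> * w)) (Yc f) (Zc f) (Vc f))"
    unfolding G_def Let_def by (intro tame_intros t ti)
  show thesis
  proof (rule that[OF R0])
    show "tame (halfstrip A B R) hM" "tame (halfstrip A B R) hN"
      unfolding H_def[symmetric] hM_def hN_def by (intro tame_intros tG t t1)+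
    fix w and f :: "comp \<Rightarrow> complex"
    assume "w \<in> halfstrip A B R" "\<And>j. norm (f j) \<le> 1"
    with d[of w f] x1[of w] \<nu>_nz show "exp (- w) \<noteq> 1 \<and> den (exp (- w)) (exp (- w) * ?s w f) \<noteq> 0"
      by (auto simp: H_def)
  qed
qed


text \<open>Formulated at a single point, so that it can be asserted for the far points of one ray.
  The condition \<open>exp (- w) \<noteq> 1\<close> guards against \<open>inverse 0 = 0\<close> in
  the equation for \<open>Z\<close>.\<close>

definition sys :: "(complex \<Rightarrow> complex) \<Rightarrow> (complex \<Rightarrow> complex) \<Rightarrow> (complex \<Rightarrow> complex) \<Rightarrow> complex \<Rightarrow> bool" where
  "sys Y Z V w \<longleftrightarrow> exp (- w) \<noteq> 1 \<and>
     (Y has_field_derivative (1 + 2 * \<nu>) * Y w + Z w) (at w) \<and>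
     (Z has_field_derivative 2 * \<nu> * Z w + V w * inverse (1 - exp (- w))) (at w) \<and>
     (V has_field_derivative 2 * \<nu> * V w + 4 * \<nu>\<^sup>2 * Z w
        + exp (- w) * G (exp (- w)) (exp (- 2 * \<nu> * w)) (Y w) (Z w) (V w)) (at w)"

lemma sysD:
  assumes "sys Y Z V w"
  shows "exp (- w) \<noteq> 1"
    "(Y has_field_derivative (1 + 2 * \<nu>) * Y w + Z w) (at w)"
    "(Z has_field_derivative 2 * \<nu> * Z w + V w * inverse (1 - exp (- w))) (at w)"
    "(V has_field_derivative 2 * \<nu> * V w + 4 * \<nu>\<^sup>2 * Z w
        + exp (- w) * G (exp (- w)) (exp (- 2 * \<nu> * w)) (Y w) (Z w) (V w)) (at w)"
  using assms unfolding sys_def by blast+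

text \<open>The affine change of variables inverse to \<open>Yc\<close>, \<open>Zc\<close>,
  \<open>Vc\<close>; it moves the limit point to the origin.\<close>

definition coord :: "(complex \<Rightarrow> complex) \<Rightarrow> (complex \<Rightarrow> complex) \<Rightarrow> (complex \<Rightarrow> complex) \<Rightarrow> comp \<Rightarrow> complex \<Rightarrow> complex" where
  "coord Y Z V i = (case i of CY \<Rightarrow> (\<lambda>w. \<nu> * (Y w - C)) | CM \<Rightarrow> (\<lambda>w. V w + 2 * \<nu> * Z w)
     | CN \<Rightarrow> (\<lambda>w. V w - 2 * \<nu> * Z w - N0))"

lemma coord_simps:
  "coord Y Z V CY = (\<lambda>w. \<nu> * (Y w - C))" "coord Y Z V CM = (\<lambda>w. V w + 2 * \<nu> * Z w)"
  "coord Y Z V CN = (\<lambda>w. V w - 2 * \<nu> * Z w - N0)"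
  by (simp_all add: coord_def)

lemma coord_inverse [simp]:
  "Yc (\<lambda>j. coord Y Z V j w) = Y w" "Zc (\<lambda>j. coord Y Z V j w) = Z w" "Vc (\<lambda>j. coord Y Z V j w) = V w"
  using \<nu>_nz by (simp_all add: Yc_def Zc_def Vc_def coord_simps field_simps)

lemma sys_imp_coord:
  assumes "sys Y Z V w"
  shows "(coord Y Z V i has_field_derivative ev i * coord Y Z V i w + rhs i w (\<lambda>j. coord Y Z V j w)) (at w)"
proof -
  note d = sysD(2-4)[OF assms]
  define r where "r = V w * inverse (1 - exp (- w))"
  have r: "r = V w + exp (- w) * r"
    using sysD(1)[OF assms] by (simp add: r_def field_simps)
  define g where "g = G (exp (- w)) (exp (- 2 * \<nu> * w)) (Y w) (Z w) (V w)"
  have h: "hM w (\<lambda>j. coord Y Z V j w) = g + 2 * \<nu> * r" "hN w (\<lambda>j. coord Y Z V j w) = g - 2 * \<nu> * r"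
    by (simp_all add: hM_def hN_def g_def r_def)
  note d = d[folded r_def g_def]
  show ?thesis
  proof (cases i)
    case CY
    have "((\<lambda>w. \<nu> * (Y w - C)) has_field_derivative \<nu> * ((1 + 2 * \<nu>) * Y w + Z w)) (at w)"
      by (auto intro!: derivative_eq_intros d(1))
    moreover have "\<nu> * ((1 + 2 * \<nu>) * Y w + Z w) = ev i * coord Y Z V i w + rhs i w (\<lambda>j. coord Y Z V j w)"
      by (simp add: CY ev_def coord_simps rhs_def N0_def field_simps)
    ultimately show ?thesis by (simp add: CY coord_simps)
  next
    case CM
    have "((\<lambda>w. V w + 2 * \<nu> * Z w) has_field_derivative
        2 * \<nu> * V w + 4 * \<nu>\<^sup>2 * Z w + exp (- w) * g + 2 * \<nu> * (2 * \<nu> * Z w + r)) (at w)"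
      by (intro DERIV_add DERIV_cmult d)
    moreover have "2 * \<nu> * V w + 4 * \<nu>\<^sup>2 * Z w + exp (- w) * g + 2 * \<nu> * (2 * \<nu> * Z w + r)
       = ev i * coord Y Z V i w + rhs i w (\<lambda>j. coord Y Z V j w)"
      by (subst r) (simp add: CM ev_def rhs_def h coord_simps algebra_simps power2_eq_square)
    ultimately show ?thesis by (simp add: CM coord_simps)
  next
    case CN
    have "((\<lambda>w. V w - 2 * \<nu> * Z w - N0) has_field_derivative
        2 * \<nu> * V w + 4 * \<nu>\<^sup>2 * Z w + exp (- w) * g - 2 * \<nu> * (2 * \<nu> * Z w + r) - 0) (at w)"
      by (intro DERIV_diff DERIV_cmult DERIV_const d)
    moreover have "2 * \<nu> * V w + 4 * \<nu>\<^sup>2 * Z w + exp (- w) * g - 2 * \<nu> * (2 * \<nu> * Z w + r) - 0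
       = ev i * coord Y Z V i w + rhs i w (\<lambda>j. coord Y Z V j w)"
      by (subst r) (simp add: CN ev_def rhs_def h coord_simps algebra_simps power2_eq_square)
    ultimately show ?thesis by (simp add: CN coord_simps)
  qed
qed

lemma coord_imp_sys:
  fixes f :: "comp \<Rightarrow> complex \<Rightarrow> complex"
  assumes d: "\<And>i. (f i has_field_derivative ev i * f i w + rhs i w (\<lambda>j. f j w)) (at w)"
    and nz: "exp (- w) \<noteq> 1"
  shows "sys (\<lambda>w. Yc (\<lambda>j. f j w)) (\<lambda>w. Zc (\<lambda>j. f j w)) (\<lambda>w. Vc (\<lambda>j. f j w)) w"
proof -
  define r where "r = Vc (\<lambda>j. f j w) * inverse (1 - exp (- w))"
  have r: "r = Vc (\<lambda>j. f j w) + exp (- w) * r"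
    using nz by (simp add: r_def field_simps)
  define g where "g = G (exp (- w)) (exp (- 2 * \<nu> * w)) (Yc (\<lambda>j. f j w)) (Zc (\<lambda>j. f j w)) (Vc (\<lambda>j. f j w))"
  have h: "hM w (\<lambda>j. f j w) = g + 2 * \<nu> * r" "hN w (\<lambda>j. f j w) = g - 2 * \<nu> * r"
    by (simp_all add: hM_def hN_def g_def r_def)
  define m n where "m = f CM w" and "n = f CN w"
  have Y: "(f CY has_field_derivative (1 + 2 * \<nu>) * f CY w + (m - n) * inverse 4) (at w)"
    using d[of CY] by (simp add: ev_def rhs_def m_def n_def)
  have M: "(f CM has_field_derivative 4 * \<nu> * m + exp (- w) * (g + 2 * \<nu> * r)) (at w)"
    using d[of CM] by (simp add: ev_def rhs_def h m_def)
  have N: "(f CN has_field_derivative exp (- w) * (g - 2 * \<nu> * r)) (at w)"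
    using d[of CN] by (simp add: ev_def rhs_def h)
  have "((\<lambda>w. Yc (\<lambda>j. f j w)) has_field_derivative 0 + ((1 + 2 * \<nu>) * f CY w + (m - n) * inverse 4) * inverse \<nu>) (at w)"
    unfolding Yc_def by (intro DERIV_add DERIV_const DERIV_cmult_right Y)
  also have "0 + ((1 + 2 * \<nu>) * f CY w + (m - n) * inverse 4) * inverse \<nu> = (1 + 2 * \<nu>) * Yc (\<lambda>j. f j w) + Zc (\<lambda>j. f j w)"
    using \<nu>_nz by (simp add: Yc_def Zc_def m_def n_def N0_def field_simps)
  finally have 1: "((\<lambda>w. Yc (\<lambda>j. f j w)) has_field_derivative (1 + 2 * \<nu>) * Yc (\<lambda>j. f j w) + Zc (\<lambda>j. f j w)) (at w)" .
  have "((\<lambda>w. Zc (\<lambda>j. f j w)) has_field_derivative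
      (4 * \<nu> * m + exp (- w) * (g + 2 * \<nu> * r) - (exp (- w) * (g - 2 * \<nu> * r) + 0)) * inverse (4 * \<nu>)) (at w)"
    unfolding Zc_def by (intro DERIV_add DERIV_diff DERIV_const DERIV_cmult_right M N)
  also have "(4 * \<nu> * m + exp (- w) * (g + 2 * \<nu> * r) - (exp (- w) * (g - 2 * \<nu> * r) + 0)) * inverse (4 * \<nu>) = m + exp (- w) * r"
    using \<nu>_nz by (simp add: field_simps)
  also have "\<dots> = 2 * \<nu> * Zc (\<lambda>j. f j w) + r"
    using \<nu>_nz by (subst (2) r) (simp add: Zc_def Vc_def m_def field_simps)
  finally have 2: "((\<lambda>w. Zc (\<lambda>j. f j w)) has_field_derivative 2 * \<nu> * Zc (\<lambda>j. f j w) + r) (at w)" .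
  have "((\<lambda>w. Vc (\<lambda>j. f j w)) has_field_derivative
      (4 * \<nu> * m + exp (- w) * (g + 2 * \<nu> * r) + (exp (- w) * (g - 2 * \<nu> * r) + 0)) * inverse 2) (at w)"
    unfolding Vc_def by (intro DERIV_add DERIV_diff DERIV_const DERIV_cmult_right M N)
  also have "(4 * \<nu> * m + exp (- w) * (g + 2 * \<nu> * r) + (exp (- w) * (g - 2 * \<nu> * r) + 0)) * inverse 2
      = 2 * \<nu> * Vc (\<lambda>j. f j w) + 4 * \<nu>\<^sup>2 * Zc (\<lambda>j. f j w) + exp (- w) * g"
    using \<nu>_nz by (simp add: Zc_def Vc_def m_def field_simps power2_eq_square)
  finally have 3: "((\<lambda>w. Vc (\<lambda>j. f j w)) has_field_derivative
      2 * \<nu> * Vc (\<lambda>j. f j w) + 4 * \<nu>\<^sup>2 * Zc (\<lambda>j. f j w) + exp (- w) * g) (at w)" .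
  show ?thesis
    unfolding sys_def using nz 1 2[unfolded r_def] 3[unfolded g_def] by blast
qed

section \<open>Estimates for the triangular right-hand side\<close>

lemma Re_ev: "0 \<le> Re (ev i)"
  using Re_\<nu> by (cases i) (auto simp: ev_def)

text \<open>\<open>CY\<close> is excluded from the last two bounds: its right-hand side is the
  linear coupling to \<open>CM\<close> and \<open>CN\<close>, which has no factor \<open>x\<close>.
  For the other two this factor supplies \<open>exp (- Re w)\<close>.\<close>

lemma h_bounds:
  obtains R K where "0 \<le> R" "0 \<le> K"
    "\<And>i H f. H \<subseteq> halfstrip A B R \<Longrightarrow> (\<And>j. f j holomorphic_on H) \<Longrightarrow> (\<And>j w. w \<in> H \<Longrightarrow> norm (f j w) \<le> 1)
      \<Longrightarrow> (\<lambda>w. rhs i w (\<lambda>j. f j w)) holomorphic_on H"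
    "\<And>w f. w \<in> halfstrip A B R \<Longrightarrow> (\<And>j. norm (f j) \<le> 1) \<Longrightarrow>
      exp (- w) \<noteq> 1 \<and> den (exp (- w)) (exp (- w) * (exp (- 2 * \<nu> * w) * (Yc f + Zc f))) \<noteq> 0"
    "\<And>i w f. i \<noteq> CY \<Longrightarrow> w \<in> halfstrip A B R \<Longrightarrow> (\<And>j. norm (f j) \<le> 1) \<Longrightarrow> norm (rhs i w f) \<le> K * exp (- Re w)"
    "\<And>i w f g d. i \<noteq> CY \<Longrightarrow> w \<in> halfstrip A B R \<Longrightarrow> (\<And>j. norm (f j) \<le> 1) \<Longrightarrow> (\<And>j. norm (g j) \<le> 1)
      \<Longrightarrow> (\<And>j. norm (f j - g j) \<le> d) \<Longrightarrow> norm (rhs i w f - rhs i w g) \<le> K * d * exp (- Re w)"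
proof -
  obtain R where R: "0 \<le> R" and t: "tame (halfstrip A B R) hM" "tame (halfstrip A B R) hN"
    and nz: "\<And>w f. w \<in> halfstrip A B R \<Longrightarrow> (\<And>j. norm (f j) \<le> 1) \<Longrightarrow>
        exp (- w) \<noteq> 1 \<and> den (exp (- w)) (exp (- w) * (exp (- 2 * \<nu> * w) * (Yc f + Zc f))) \<noteq> 0"
    by (rule tame_h[of A B]) blast
  have "tame (halfstrip A B R) (\<lambda>w f. exp (- w))"
    by (rule tame_param[of _ _ 1]) (use R in \<open>auto intro!: holomorphic_intros simp: halfstrip_def\<close>)
  then have trhs: "tame (halfstrip A B R) (rhs i)" for i
  proof (cases i)
    case CY
    have "tame (halfstrip A B R) (\<lambda>w f. (f CM - f CN) * inverse 4)"
      by (intro tame_intros)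
    then show ?thesis by (simp add: CY rhs_def[abs_def])
  qed (use t in \<open>auto simp: rhs_def[abs_def] intro!: tame_mult\<close>)
  define h where "h i = (if i = CM then hM else hN)" for i
  have rhs_h: "rhs i w f = exp (- w) * h i w f" if "i \<noteq> CY" for i w f
    using that by (cases i) (auto simp: rhs_def h_def)
  obtain K1 where K1: "0 \<le> K1" "\<And>w f. w \<in> halfstrip A B R \<Longrightarrow> (\<And>j. norm (f j) \<le> 1) \<Longrightarrow> norm (hM w f) \<le> K1"
    "\<And>w f g d. w \<in> halfstrip A B R \<Longrightarrow> (\<And>j. norm (f j) \<le> 1) \<Longrightarrow> (\<And>j. norm (g j) \<le> 1) \<Longrightarrow> (\<And>j. norm (f j - g j) \<le> d)
      \<Longrightarrow> norm (hM w f - hM w g) \<le> K1 * d"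
    by (rule tame_bound[OF t(1)]) blast
  obtain K2 where K2: "0 \<le> K2" "\<And>w f. w \<in> halfstrip A B R \<Longrightarrow> (\<And>j. norm (f j) \<le> 1) \<Longrightarrow> norm (hN w f) \<le> K2"
    "\<And>w f g d. w \<in> halfstrip A B R \<Longrightarrow> (\<And>j. norm (f j) \<le> 1) \<Longrightarrow> (\<And>j. norm (g j) \<le> 1) \<Longrightarrow> (\<And>j. norm (f j - g j) \<le> d)
      \<Longrightarrow> norm (hN w f - hN w g) \<le> K2 * d"
    by (rule tame_bound[OF t(2)]) blast
  have b: "norm (h i w f) \<le> K1 + K2" if "w \<in> halfstrip A B R" "\<And>j. norm (f j) \<le> 1" for i w f
    using K1(1) K2(1) K1(2)[of w f, OF that] K2(2)[of w f, OF that] by (simp add: h_def)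
  have l: "norm (h i w f - h i w g) \<le> (K1 + K2) * d"
    if "w \<in> halfstrip A B R" "\<And>j. norm (f j) \<le> 1" "\<And>j. norm (g j) \<le> 1" "\<And>j. norm (f j - g j) \<le> d" for i w f g d
  proof -
    have "0 \<le> d" using that(4) norm_ge_zero order_trans by blast
    then have "0 \<le> K1 * d" "0 \<le> K2 * d" using K1(1) K2(1) by auto
    then show ?thesis
      using K1(3)[of w f g d, OF that] K2(3)[of w f g d, OF that] by (auto simp: h_def ring_distribs)
  qed
  show thesis
  proof (rule that[OF R, of "K1 + K2"])
    show "0 \<le> K1 + K2" using K1(1) K2(1) by simp
  next
    fix i H and f :: "comp \<Rightarrow> complex \<Rightarrow> complex"
    assume "H \<subseteq> halfstrip A B R" "\<And>j. f j holomorphic_on H" "\<And>j w. w \<in> H \<Longrightarrow> norm (f j w) \<le> 1"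
    then show "(\<lambda>w. rhs i w (\<lambda>j. f j w)) holomorphic_on H" by (rule tame_holomorphic[OF trhs])
  next
    fix i w and f :: "comp \<Rightarrow> complex"
    assume *: "i \<noteq> CY" "w \<in> halfstrip A B R" "\<And>j. norm (f j) \<le> 1"
    show "norm (rhs i w f) \<le> (K1 + K2) * exp (- Re w)"
      unfolding rhs_h[OF *(1)] norm_mult using mult_right_mono[OF b[of w f i, OF *(2-3)], of "exp (- Re w)"]
      by (simp add: mult.commute)
  next
    fix i w d and f g :: "comp \<Rightarrow> complex"
    assume *: "i \<noteq> CY" "w \<in> halfstrip A B R" "\<And>j. norm (f j) \<le> 1" "\<And>j. norm (g j) \<le> 1" "\<And>j. norm (f j - g j) \<le> d"
    show "norm (rhs i w f - rhs i w g) \<le> (K1 + K2) * d * exp (- Re w)"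
      unfolding rhs_h[OF *(1)] right_diff_distrib[symmetric] norm_mult
      using mult_right_mono[OF l[of w f g d i, OF *(2-5)], of "exp (- Re w)"]
      by (simp add: mult.commute)
  qed (use nz in blast)
qed

text \<open>The two coefficients of modulus 1/4 add up to the contraction factor 1/2. It does not
  depend on \<open>w\<close>, so enlarging \<open>R\<close> could not have reduced it.\<close>

lemma norm_rhs_CY:
  assumes "norm (f CM - g CM) \<le> d" "norm (f CN - g CN) \<le> d"
  shows "norm (rhs CY w f - rhs CY w g) \<le> d / 2"
proof -
  have "rhs CY w f - rhs CY w g = ((f CM - g CM) - (f CN - g CN)) / 4"
    by (simp add: rhs_def field_simps)
  also have "norm \<dots> \<le> (d + d) / 4"
    using norm_triangle_ineq4[of "f CM - g CM" "f CN - g CN"] assms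
    by (simp add: norm_divide)
  finally show ?thesis by simp
qed

section \<open>Existence for the system, and uniqueness along a ray\<close>

lemma sys_solution:
  obtains R K Y Z V where "0 \<le> R" "0 \<le> K"
    "\<And>w. w \<in> halfstrip A B R \<Longrightarrow> sys Y Z V w"
    "\<And>w. w \<in> halfstrip A B R \<Longrightarrow> den (exp (- w)) (exp (- w) * (exp (- 2 * \<nu> * w) * (Y w + Z w))) \<noteq> 0"
    "\<And>w. w \<in> halfstrip A B R \<Longrightarrow> norm (Y w - C) \<le> K * exp (- Re w)"
    "\<And>w. w \<in> halfstrip A B R \<Longrightarrow> norm (Y w) \<le> K \<and> norm (Z w) \<le> K \<and> norm (V w) \<le> K"
proof -
  obtain R0 K where R0: "0 \<le> R0" "0 \<le> K"
    and hol: "\<And>i H f. H \<subseteq> halfstrip A B R0 \<Longrightarrow> (\<And>j. f j holomorphic_on H) \<Longrightarrow> (\<And>j w. w \<in> H \<Longrightarrow> norm (f j w) \<le> 1)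
      \<Longrightarrow> (\<lambda>w. rhs i w (\<lambda>j. f j w)) holomorphic_on H"
    and nz: "\<And>w f. w \<in> halfstrip A B R0 \<Longrightarrow> (\<And>j. norm (f j) \<le> 1) \<Longrightarrow>
      exp (- w) \<noteq> 1 \<and> den (exp (- w)) (exp (- w) * (exp (- 2 * \<nu> * w) * (Yc f + Zc f))) \<noteq> 0"
    and bd: "\<And>i w f. i \<noteq> CY \<Longrightarrow> w \<in> halfstrip A B R0 \<Longrightarrow> (\<And>j. norm (f j) \<le> 1) \<Longrightarrow> norm (rhs i w f) \<le> K * exp (- Re w)"
    and lip: "\<And>i w f g d. i \<noteq> CY \<Longrightarrow> w \<in> halfstrip A B R0 \<Longrightarrow> (\<And>j. norm (f j) \<le> 1) \<Longrightarrow> (\<And>j. norm (g j) \<le> 1)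
      \<Longrightarrow> (\<And>j. norm (f j - g j) \<le> d) \<Longrightarrow> norm (rhs i w f - rhs i w g) \<le> K * d * exp (- Re w)"
    by (rule h_bounds[of A B]) blast
  \<comment> \<open>This makes \<open>K * exp (- R) \<le> 1 / 2\<close>, which serves both as the
    Lipschitz factor for \<open>CM\<close>, \<open>CN\<close> and as the size condition on the ball.
    The summand 1 covers \<open>K = 0\<close>.\<close>
  define R where "R = max R0 (ln (2 * K + 1))"
  define H where "H = halfstrip A B R"
  have sub: "H \<subseteq> halfstrip A B R0" unfolding H_def R_def by (rule halfstrip_mono) simp
  have KR: "2 * K * exp (- R) \<le> 1"
  proof -
    have "exp (- R) \<le> exp (- ln (2 * K + 1))" by (simp add: R_def)
    also have "\<dots> = 1 / (2 * K + 1)" using R0(2) by (simp add: exp_minus divide_inverse)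
    finally have "2 * K * exp (- R) \<le> 2 * K * (1 / (2 * K + 1))"
      using R0(2) by (intro mult_left_mono) auto
    also have "\<dots> \<le> 1" using R0(2) by simp
    finally show ?thesis .
  qed
  have Kw: "K * exp (- Re w) \<le> 1 / 2" if "w \<in> H" for w
  proof -
    have "K * exp (- Re w) \<le> K * exp (- R)"
      using that R0(2) by (intro mult_left_mono) (auto simp: H_def halfstrip_def)
    then show ?thesis using KR by linarith
  qed
  obtain f where f: "\<And>i w. w \<in> H \<Longrightarrow> (f i has_field_derivative ev i * f i w + rhs i w (\<lambda>j. f j w)) (at w)"
    "\<And>i w. w \<in> H \<Longrightarrow> norm (f i w) \<le> 2 * K * exp (- Re w)"
    "\<And>i w. w \<in> H \<Longrightarrow> norm (f i w) \<le> 1"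
  proof (rule semilinear_ode_solution[of A B R rhs K ev, folded H_def])
    show "(\<lambda>w. rhs i w (\<lambda>j. f j w)) holomorphic_on H"
      if "\<And>j. f j holomorphic_on H" "\<And>j w. w \<in> H \<Longrightarrow> norm (f j w) \<le> 1" for i f
      by (rule hol[OF sub that])
    show "norm (rhs i w f - rhs i w g) \<le> d / 2"
      if *: "w \<in> H" "\<And>j. norm (f j) \<le> 1" "\<And>j. norm (g j) \<le> 1" "\<And>j. norm (f j - g j) \<le> d" for i w f g d
    proof (cases "i = CY")
      case True
      then show ?thesis using norm_rhs_CY *(4) by blast
    next
      case False
      have "0 \<le> d" using *(4) norm_ge_zero order_trans by blast
      have "norm (rhs i w f - rhs i w g) \<le> K * d * exp (- Re w)"
        using False * sub by (intro lip) auto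
      also have "\<dots> = d * (K * exp (- Re w))" by simp
      also have "\<dots> \<le> d * (1 / 2)"
        using \<open>0 \<le> d\<close> by (intro mult_left_mono Kw *)
      finally show ?thesis by simp
    qed
    show "norm (rhs i w (\<lambda>_. 0)) \<le> K * exp (- Re w)" if "w \<in> H" for i w
    proof (cases "i = CY")
      case True
      then show ?thesis using R0(2) by (simp add: rhs_def)
    next
      case False
      then show ?thesis using that sub by (intro bd) auto
    qed
  qed (use R0 KR Re_ev in auto)
  let ?f = "\<lambda>w j. f j w"
  define Y where "Y = (\<lambda>w. Yc (?f w))"
  define Z where "Z = (\<lambda>w. Zc (?f w))"
  define V where "V = (\<lambda>w. Vc (?f w))"
  define n where "n = norm (inverse \<nu>)"
  have n: "0 \<le> n" by (simp add: n_def)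
  \<comment> \<open>The sum of the bounds for all conclusions, so that one constant serves each of
    them.\<close>
  define K' where "K' = 2 * K * n + (norm C + n) + (2 + norm N0) * norm (inverse (4 * \<nu>)) + (2 + norm N0)"
  have YC: "norm (Y w - C) \<le> 2 * K * n * exp (- Re w)" if "w \<in> H" for w
  proof -
    have "norm (Y w - C) = norm (f CY w) * n"
      by (simp add: Y_def Yc_def n_def norm_mult)
    also have "\<dots> \<le> 2 * K * exp (- Re w) * n"
      using f(2)[OF that] n by (intro mult_right_mono)
    finally show ?thesis by (simp add: algebra_simps)
  qed
  have K'0: "2 * K * n \<le> K'" "norm C + n \<le> K'" "(2 + norm N0) * norm (inverse (4 * \<nu>)) \<le> K'" "2 + norm N0 \<le> K'"
    using R0(2) n unfolding K'_def by simp_all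
  have K'1: "0 \<le> K'" using K'0(4) norm_ge_zero[of N0] by linarith
  show thesis
  proof (rule that[of R K' Y Z V, folded H_def])
    show "0 \<le> R" using R0 by (simp add: R_def)
    show "0 \<le> K'" by (rule K'1)
    fix w assume w: "w \<in> H"
    show "sys Y Z V w" unfolding Y_def Z_def V_def
      by (rule coord_imp_sys[OF f(1)[OF w]]) (use nz[of w "?f w"] f(3)[OF w] w sub in auto)
    show "den (exp (- w)) (exp (- w) * (exp (- 2 * \<nu> * w) * (Y w + Z w))) \<noteq> 0"
      unfolding Y_def Z_def using nz[of w "?f w"] f(3)[OF w] w sub by blast
    show "norm (Y w - C) \<le> K' * exp (- Re w)"
      by (rule order_trans[OF YC[OF w] mult_right_mono[OF K'0(1)]]) simp
    have "norm (Y w) \<le> norm C + norm (f CY w) * n"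
      unfolding Y_def Yc_def using norm_triangle_ineq[of C "f CY w * inverse \<nu>"] by (simp add: n_def norm_mult)
    also have "\<dots> \<le> norm C + 1 * n"
      using n f(3)[OF w] by (intro add_mono mult_right_mono) auto
    finally have 1: "norm (Y w) \<le> K'" using K'0(2) by simp
    have "norm (f CM w - (f CN w + N0)) \<le> 2 + norm N0" "norm (f CM w + (f CN w + N0)) \<le> 2 + norm N0"
      using norm_triangle_ineq[of "f CN w" N0] f(3)[OF w, of CM] f(3)[OF w, of CN]
        norm_triangle_ineq4[of "f CM w" "f CN w + N0"] norm_triangle_ineq[of "f CM w" "f CN w + N0"] by linarith+
    then have "norm (Z w) \<le> (2 + norm N0) * norm (inverse (4 * \<nu>))" "norm (V w) \<le> (2 + norm N0) * norm (inverse 2 :: complex)"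
      unfolding Z_def Zc_def V_def Vc_def norm_mult by (intro mult_right_mono; simp)+
    then have "norm (Z w) \<le> K'" "norm (V w) \<le> K'"
      using K'0(3,4) norm_ge_zero[of N0] by (simp_all add: norm_inverse del: norm_ge_zero)
    with 1 show "norm (Y w) \<le> K' \<and> norm (Z w) \<le> K' \<and> norm (V w) \<le> K'" by blast
  qed
qed

text \<open>The two solutions are only known to tend to 0, without a rate. The contraction is
  therefore run on bounds for all far points of the ray, starting from the trivial bound 2 and
  halving it repeatedly. Both the Lipschitz bounds and \<open>linear_ode_decay\<close> involve
  nothing but points of the ray.\<close>

lemma sys_unique_on_ray:
  assumes w0: "A < Im w0" "Im w0 < B"
    and sys: "\<forall>\<^sub>F s in at_top. sys Y Z V (w0 + of_real s)" "\<forall>\<^sub>F s in at_top. sys Y' Z' V' (w0 + of_real s)"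
    and lim: "\<And>i. ((\<lambda>s. coord Y Z V i (w0 + of_real s)) \<longlongrightarrow> 0) at_top"
    and lim': "\<And>i. ((\<lambda>s. coord Y' Z' V' i (w0 + of_real s)) \<longlongrightarrow> 0) at_top"
  shows "\<exists>S. \<forall>s\<ge>S. Y (w0 + of_real s) = Y' (w0 + of_real s)"
proof -
  obtain R0 K where R0: "0 \<le> R0" "0 \<le> K"
    and lip: "\<And>i w f g d. i \<noteq> CY \<Longrightarrow> w \<in> halfstrip A B R0 \<Longrightarrow> (\<And>j. norm (f j) \<le> 1) \<Longrightarrow> (\<And>j. norm (g j) \<le> 1)
      \<Longrightarrow> (\<And>j. norm (f j - g j) \<le> d) \<Longrightarrow> norm (rhs i w f - rhs i w g) \<le> K * d * exp (- Re w)"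
    by (rule h_bounds[of A B]) blast
  let ?w = "\<lambda>s. w0 + of_real s"
  define f where "f = coord Y Z V"
  define g where "g = coord Y' Z' V'"
  have ev: "\<forall>\<^sub>F s in at_top. norm (f i (?w s)) < 1" "\<forall>\<^sub>F s in at_top. norm (g i (?w s)) < 1" for i
    unfolding f_def g_def using tendstoD[OF lim, of 1 i] tendstoD[OF lim', of 1 i] by (simp_all add: dist_norm)
  have "((\<lambda>s. K * exp (- Re w0 - s)) \<longlongrightarrow> K * 0) at_top"
    by (intro tendsto_intros exp_neg_real_tendsto_0)
  then have "\<forall>\<^sub>F s in at_top. K * exp (- Re w0 - s) < 1 / 2"
    by (rule order_tendstoD) simp
  then have "\<forall>\<^sub>F s in at_top. (\<forall>i. norm (f i (?w s)) \<le> 1 \<and> norm (g i (?w s)) \<le> 1)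
      \<and> K * exp (- Re w0 - s) \<le> 1 / 2 \<and> R0 - Re w0 < s \<and> sys Y Z V (?w s) \<and> sys Y' Z' V' (?w s)"
    using ev[of CY] ev[of CM] ev[of CN] eventually_gt_at_top[of "R0 - Re w0"] sys
  proof eventually_elim
    case (elim s)
    have "norm (f i (?w s)) \<le> 1 \<and> norm (g i (?w s)) \<le> 1" for i
      using elim by (cases i) auto
    then show ?case using elim by auto
  qed
  then obtain S where S: "\<And>s i. S \<le> s \<Longrightarrow> norm (f i (?w s)) \<le> 1" "\<And>s i. S \<le> s \<Longrightarrow> norm (g i (?w s)) \<le> 1"
      "\<And>s. S \<le> s \<Longrightarrow> K * exp (- Re w0 - s) \<le> 1 / 2" "\<And>s. S \<le> s \<Longrightarrow> R0 - Re w0 < s" "\<And>s. S \<le> s \<Longrightarrow> sys Y Z V (?w s)" "\<And>s. S \<le> s \<Longrightarrow> sys Y' Z' V' (?w s)"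
    unfolding eventually_at_top_linorder by blast
  have H: "?w s \<in> halfstrip A B R0" if "S \<le> s" for s
    using w0 S(4)[OF that] by (simp add: halfstrip_def)
  have halve: "norm (f i (?w s) - g i (?w s)) \<le> d / 2"
    if d: "\<And>i s. S \<le> s \<Longrightarrow> norm (f i (?w s) - g i (?w s)) \<le> d" and s: "S \<le> s" for d i s
  proof -
    have "0 \<le> d" using d[OF order_refl] norm_ge_zero order_trans by blast
    have decay: "norm (f i (?w s) - g i (?w s)) \<le> L * exp (- Re w0 - s)"
      if s: "S \<le> s" and e: "\<And>s'. s \<le> s' \<Longrightarrow> norm (rhs i (?w s') (\<lambda>j. f j (?w s')) - rhs i (?w s') (\<lambda>j. g j (?w s'))) \<le> L * exp (- Re w0 - s')"
      for i s L
    proof -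
      have w: "?w s + of_real s' = ?w (s + s')" for s' by simp
      have "norm ((\<lambda>w. f i w - g i w) (?w s)) \<le> L * exp (- Re (?w s))"
      proof (rule linear_ode_decay[where \<mu> = "ev i" and e = "\<lambda>w. rhs i w (\<lambda>j. f j w) - rhs i w (\<lambda>j. g j w)"], unfold w)
        fix s' :: real assume s': "0 \<le> s'"
        let ?v = "?w (s + s')"
        have "S \<le> s + s'" using s s' by simp
        from DERIV_diff[OF sys_imp_coord[OF S(5)[OF this]] sys_imp_coord[OF S(6)[OF this]], of i i]
        show "((\<lambda>w. f i w - g i w) has_field_derivative ev i * (f i ?v - g i ?v) +
            (rhs i ?v (\<lambda>j. f j ?v) - rhs i ?v (\<lambda>j. g j ?v))) (at ?v)"
          unfolding f_def g_def by (simp add: algebra_simps)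
        show "norm (rhs i ?v (\<lambda>j. f j ?v) - rhs i ?v (\<lambda>j. g j ?v)) \<le> L * exp (- Re (?w s) - s')"
        proof -
          have eq: "- Re (?w s) - s' = - Re w0 - (s + s')" by simp
          show ?thesis unfolding eq by (rule e) (use s' in simp)
        qed
      next
        have lim1: "((\<lambda>s. f i (?w s) - g i (?w s)) \<longlongrightarrow> 0 - 0) at_top"
          unfolding f_def g_def by (intro tendsto_diff lim lim')
        have lim2: "filterlim (\<lambda>s'. s + s') at_top at_top"
          by (rule filterlim_tendsto_add_at_top[OF tendsto_const filterlim_ident])
        show "((\<lambda>s'. f i (?w (s + s')) - g i (?w (s + s'))) \<longlongrightarrow> 0) at_top"
          using filterlim_compose[OF lim1 lim2] by simp
      qed (rule Re_ev)
      then show ?thesis by simp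
    qed
    have rl: "norm (rhs i (?w s') (\<lambda>j. f j (?w s')) - rhs i (?w s') (\<lambda>j. g j (?w s'))) \<le> K * d * exp (- Re w0 - s')"
      if "i \<noteq> CY" "S \<le> s'" for i s'
    proof -
      have "norm (rhs i (?w s') (\<lambda>j. f j (?w s')) - rhs i (?w s') (\<lambda>j. g j (?w s'))) \<le> K * d * exp (- Re (?w s'))"
        by (rule lip) (use that H S d in auto)
      then show ?thesis by simp
    qed
    have MN: "norm (f i (?w s) - g i (?w s)) \<le> K * d * exp (- Re w0 - s)" if "i \<noteq> CY" "S \<le> s" for i s
      by (rule decay) (use that rl in auto)
    \<comment> \<open>\<open>linear_ode_decay\<close> demands a decaying inhomogeneity, but the
      coupling in \<open>CY\<close> carries no factor \<open>x\<close>. The decay of the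
      \<open>CM\<close> and \<open>CN\<close> differences, already established, supplies it.\<close>
    have "norm (f i (?w s) - g i (?w s)) \<le> K * d * exp (- Re w0 - s)" for i
    proof (cases "i = CY")
      case True
      have "norm (f i (?w s) - g i (?w s)) \<le> K * d * exp (- Re w0 - s)"
      proof (rule decay[OF s])
        fix s' assume "s \<le> s'"
        then have s': "S \<le> s'" using s by simp
        have "norm (rhs CY (?w s') (\<lambda>j. f j (?w s')) - rhs CY (?w s') (\<lambda>j. g j (?w s'))) \<le> (K * d * exp (- Re w0 - s')) / 2"
          by (intro norm_rhs_CY MN s') auto
        also have "\<dots> \<le> K * d * exp (- Re w0 - s')" using R0(2) \<open>0 \<le> d\<close> by simp
        finally show "norm (rhs i (?w s') (\<lambda>j. f j (?w s')) - rhs i (?w s') (\<lambda>j. g j (?w s'))) \<le> K * d * exp (- Re w0 - s')"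
          using True by simp
      qed
      then show ?thesis .
    qed (use MN s in auto)
    also have "K * d * exp (- Re w0 - s) = d * (K * exp (- Re w0 - s))" by simp
    also have "\<dots> \<le> d * (1 / 2)" by (rule mult_left_mono[OF S(3)[OF s] \<open>0 \<le> d\<close>])
    finally show ?thesis by simp
  qed
  have bound: "\<forall>i s. S \<le> s \<longrightarrow> norm (f i (?w s) - g i (?w s)) \<le> 2 * (1 / 2) ^ n" for n
  proof (induction n)
    case 0
    have "norm (f i (?w s) - g i (?w s)) \<le> 2" if "S \<le> s" for i s
      using norm_triangle_ineq4[of "f i (?w s)" "g i (?w s)"] S(1,2)[OF that, of i] by linarith
    then show ?case by simp
  next
    case (Suc n)
    then show ?case using halve[of "2 * (1 / 2) ^ n"] by simp
  qed
  show ?thesis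
  proof (intro exI allI impI)
    fix s assume s: "S \<le> s"
    have "(\<lambda>n. 2 * (1 / 2) ^ n :: real) \<longlonglongrightarrow> 2 * 0"
      by (intro tendsto_intros LIMSEQ_power_zero) simp
    then have "norm (f CY (?w s) - g CY (?w s)) \<le> 2 * 0"
      by (rule tendsto_lowerbound) (use bound s in auto)
    then show "Y (?w s) = Y' (?w s)"
      using \<nu>_nz by (simp add: f_def g_def coord_simps)
  qed
qed

end

subsection \<open>Existence and uniqueness in the logarithmic coordinate\<close>

lemma exp_ray_tendsto_0:
  assumes "Re c > 0"
  shows "((\<lambda>s. exp (- c * (w + of_real s))) \<longlongrightarrow> 0) at_top"
proof (rule tendsto_norm_zero_cancel)
  have "filterlim (\<lambda>s. Re c * s) at_top at_top"
    using assms by (rule filterlim_tendsto_pos_mult_at_top[OF tendsto_const _ filterlim_ident])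
  from filterlim_compose[OF exp_neg_real_tendsto_0 this]
  have "((\<lambda>s. exp (- Re (c * w) - Re c * s)) \<longlongrightarrow> 0) at_top" .
  then show "((\<lambda>s. norm (exp (- c * (w + of_real s)))) \<longlongrightarrow> 0) at_top"
    by (simp add: algebra_simps)
qed

lemma halfstrip_eq_log_sector:
  assumes "\<rho> > 0"
  shows "{w \<in> log_sector A B. norm (exp w) > \<rho>} = halfstrip A B (ln \<rho>)"
proof -
  have "\<rho> < exp (Re w) \<longleftrightarrow> ln \<rho> < Re w" for w
    using assms by (metis exp_less_cancel_iff exp_ln)
  then show ?thesis by (auto simp: log_sector_def halfstrip_def)
qed

text \<open>Half-strips form a basis of this filter, because \<open>exp\<close> pulls
  \<open>|t| > r\<close> back to \<open>Re w > ln r\<close>.\<close>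

lemma eventually_log_sector_at_infinity:
  "eventually P (inf (filtercomap exp at_infinity) (principal (log_sector A B)))
     \<longleftrightarrow> (\<exists>R. \<forall>w\<in>halfstrip A B R. P w)"
proof
  assume "eventually P (inf (filtercomap exp at_infinity) (principal (log_sector A B)))"
  then obtain Q where Q: "eventually Q at_infinity" "\<And>w. Q (exp w) \<Longrightarrow> w \<in> log_sector A B \<Longrightarrow> P w"
    unfolding eventually_inf_principal eventually_filtercomap by blast
  then obtain r where r: "\<And>t. r \<le> norm t \<Longrightarrow> Q t" unfolding eventually_at_infinity by blast
  \<comment> \<open>\<open>max r 1\<close> since \<open>r\<close> need not be positive.\<close>
  have "P w" if "w \<in> halfstrip A B (ln (max r 1))" for w
  proof -
    have "w \<in> {w \<in> log_sector A B. norm (exp w) > max r 1}"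
      by (subst halfstrip_eq_log_sector) (use that in simp_all)
    then show ?thesis using r[of "exp w"] Q(2)[of w] by simp
  qed
  then show "\<exists>R. \<forall>w\<in>halfstrip A B R. P w" by blast
next
  assume "\<exists>R. \<forall>w\<in>halfstrip A B R. P w"
  then obtain R where R: "\<And>w. w \<in> halfstrip A B R \<Longrightarrow> P w" by blast
  have "eventually (\<lambda>t::complex. norm t > exp R) at_infinity"
    unfolding eventually_at_infinity by (intro exI[of _ "exp R + 1"]) auto
  moreover have "w \<in> log_sector A B \<Longrightarrow> norm (exp w) > exp R \<Longrightarrow> P w" for w
    by (rule R) (auto simp: log_sector_def halfstrip_def)
  ultimately show "eventually P (inf (filtercomap exp at_infinity) (principal (log_sector A B)))"
    unfolding eventually_inf_principal eventually_filtercomap by blast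
qed

text \<open>In the coordinate \<open>w\<close> the sector is a strip of constant width, so discs of
  one fixed radius fit around all far points of the ray and the Cauchy estimate carries the limit
  over to every derivative. This is where the asymptotics in a full sector are used, not only on a
  ray.\<close>

lemma derivatives_tendsto_0_on_ray:
  assumes hol: "f holomorphic_on halfstrip A B R"
    and lim: "(f \<longlongrightarrow> 0) (inf (filtercomap exp at_infinity) (principal (log_sector A B)))"
    and w0: "A < Im w0" "Im w0 < B"
  shows "((\<lambda>s. (deriv ^^ n) f (w0 + of_real s)) \<longlongrightarrow> 0) at_top"
proof (rule tendstoI)
  fix e :: real assume e: "e > 0"
  define r where "r = min (Im w0 - A) (B - Im w0) / 2"
  have r: "0 < r" "r < Im w0 - A" "r < B - Im w0" using w0 by (auto simp: r_def min_def)
  \<comment> \<open>Chosen to make the Cauchy bound \<open>fact n * d / r ^ n\<close> equal to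
    \<open>e / 2\<close>.\<close>
  define d where "d = e * r ^ n / (2 * fact n)"
  have d: "d > 0" using e r by (simp add: d_def)
  from tendstoD[OF lim d] obtain R' where R': "\<And>w. w \<in> halfstrip A B R' \<Longrightarrow> norm (f w) < d"
    unfolding eventually_log_sector_at_infinity by (auto simp: dist_norm)
  have "\<forall>\<^sub>F s in at_top. s > max R R' + r - Re w0" by (rule eventually_gt_at_top)
  then show "\<forall>\<^sub>F s in at_top. dist ((deriv ^^ n) f (w0 + of_real s)) 0 < e"
  proof eventually_elim
    case (elim s)
    have sub: "cball (w0 + of_real s) r \<subseteq> halfstrip A B (max R R')"
    proof
      fix w assume "w \<in> cball (w0 + of_real s) r"
      then have "norm (w - (w0 + of_real s)) \<le> r" by (simp add: dist_norm norm_minus_commute)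
      then have "\<bar>Re w - (Re w0 + s)\<bar> \<le> r" "\<bar>Im w - Im w0\<bar> \<le> r"
        using abs_Re_le_cmod[of "w - (w0 + of_real s)"] abs_Im_le_cmod[of "w - (w0 + of_real s)"] by auto
      then show "w \<in> halfstrip A B (max R R')"
        using r elim by (auto simp: halfstrip_def abs_le_iff)
    qed
    have hol': "f holomorphic_on cball (w0 + of_real s) r"
      using holomorphic_on_subset[OF hol] sub halfstrip_mono[of R "max R R'"] by fastforce
    have "norm ((deriv ^^ n) f (w0 + of_real s)) \<le> fact n * d / r ^ n"
    proof (rule Cauchy_inequality)
      show "norm (f x) \<le> d" if "norm (w0 + of_real s - x) = r" for x
      proof -
        have "x \<in> cball (w0 + of_real s) r" using that by (simp add: dist_norm)
        with sub have "x \<in> halfstrip A B R'" by (auto simp: halfstrip_def)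
        then show ?thesis using R' by (simp add: less_imp_le)
      qed
    qed (use r hol' in \<open>auto intro: holomorphic_on_subset holomorphic_on_imp_continuous_on\<close>)
    also have "\<dots> = e / 2" using r by (simp add: d_def)
    also have "\<dots> < e" using e by simp
    finally show ?case by simp
  qed
qed

text \<open>\<open>g\<close> vanishes on the nonempty open set where \<open>f\<close> does not, and
  the identity theorem does the rest. This is what justifies the division by
  \<open>u''\<close>.\<close>

lemma holomorphic_product_zero:
  assumes "open S" "connected S" "f holomorphic_on S" "g holomorphic_on S"
    and "\<And>w. w \<in> S \<Longrightarrow> f w * g w = 0" "\<not> (\<forall>w\<in>S. f w = 0)" "w \<in> S"
  shows "g w = 0"
proof -
  obtain w1 where w1: "w1 \<in> S" "f w1 \<noteq> 0" using assms(6) by blast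
  have "open (S \<inter> f -` (- {0}))"
    by (rule continuous_open_preimage[OF holomorphic_on_imp_continuous_on[OF assms(3)] assms(1)]) auto
  moreover have "w1 \<in> S \<inter> f -` (- {0})" using w1 by auto
  ultimately show ?thesis
    using analytic_continuation_open[of "S \<inter> f -` (- {0})" S g "\<lambda>_. 0" w] assms by auto
qed

section \<open>The first integral and its relation to the original equation\<close>

context painleve
begin

text \<open>Left side minus right side of the original equation in the variables \<open>p\<close>,
  \<open>z\<close>, \<open>v\<close>; in these, \<open>t\<close> no longer occurs, and the value at
  the origin is 0.\<close>

definition E :: "complex \<Rightarrow> complex \<Rightarrow> complex \<Rightarrow> complex" where
  "E p z v = (p - \<nu>\<^sup>2) * v\<^sup>2 + (quad p z)\<^sup>2 - p\<^sup>2 * (p - \<alpha>) * (p - \<beta>)"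

text \<open>Each term of the chain rule contains \<open>v\<close>: the derivatives of
  \<open>p\<close> and \<open>z\<close> are multiples of \<open>v\<close>, and \<open>E\<close>
  depends on \<open>v\<close> through \<open>v^2\<close> only. The cofactor is the third-order
  equation.\<close>

lemma E_has_derivative:
  assumes x: "x \<noteq> 1"
    and p: "(p has_field_derivative x * v w * inverse (1 - x)) (at w)"
    and z: "(z has_field_derivative v w * inverse (1 - x)) (at w)"
    and v: "(v has_field_derivative v') (at w)"
  shows "((\<lambda>w. E (p w) (z w) (v w)) has_field_derivative
      v w * inverse (1 - x) * bracket x (p w) (z w) (v w) v') (at w)"
proof -
  define r where "r = v w * inverse (1 - x)"
  have vr: "v w = (1 - x) * r" using x by (simp add: r_def)
  have "2 * a = \<nu>\<^sup>2 + \<nu>3 * \<nu>4" by (simp add: a_def)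
  \<comment> \<open>This relation turns the derivative of \<open>quad\<close> into twice the
    combination \<open>x (z - a) + (1 - x) (p - \<nu>^2)\<close> that occurs in
    \<open>bracket\<close>, up to the factor \<open>r\<close>.\<close>
  then have b: "b = 2 * \<nu>\<^sup>2 - 2 * a" by (simp add: b_def)
  have p: "(p has_field_derivative x * r) (at w)" and z: "(z has_field_derivative r) (at w)"
    using p z by (simp_all add: r_def mult.assoc)
  have q: "((\<lambda>w. quad (p w) (z w)) has_field_derivative 2 * (x * r) * z w + 2 * (p w - \<nu>\<^sup>2) * r + b * (x * r) - 2 * p w * (x * r)) (at w)"
    unfolding quad_def by (auto intro!: derivative_eq_intros p z)
  have "((\<lambda>w. E (p w) (z w) (v w)) has_field_derivative
      (x * r) * (v w)\<^sup>2 + (p w - \<nu>\<^sup>2) * (2 * v w * v')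
      + 2 * quad (p w) (z w) * (2 * (x * r) * z w + 2 * (p w - \<nu>\<^sup>2) * r + b * (x * r) - 2 * p w * (x * r))
      - (x * r) * (2 * p w * (p w - \<alpha>) * (p w - \<beta>) + (p w)\<^sup>2 * (2 * p w - \<alpha> - \<beta>))) (at w)"
    unfolding E_def
    by (rule derivative_eq_intros refl p q v)+ (simp add: algebra_simps power2_eq_square)
  also have "(x * r) * (v w)\<^sup>2 + (p w - \<nu>\<^sup>2) * (2 * v w * v')
      + 2 * quad (p w) (z w) * (2 * (x * r) * z w + 2 * (p w - \<nu>\<^sup>2) * r + b * (x * r) - 2 * p w * (x * r))
      - (x * r) * (2 * p w * (p w - \<alpha>) * (p w - \<beta>) + (p w)\<^sup>2 * (2 * p w - \<alpha> - \<beta>))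
      = r * bracket x (p w) (z w) (v w) v'"
    unfolding bracket_def den_def b by (simp add: vr algebra_simps)
  finally show ?thesis by (simp add: r_def)
qed

text \<open>Here \<open>x\<close> is \<open>1 / t\<close>; then \<open>t u' - u\<close> becomes
  \<open>z - a\<close> and \<open>u'' t (t - 1)\<close> becomes \<open>v\<close>.\<close>

lemma ode_iff_E:
  assumes "t * x = 1" "x \<noteq> 1"
  shows "ode \<nu> \<nu>3 \<nu>4 t (- \<nu>\<^sup>2 * t + a + y) (x * (y + z) - \<nu>\<^sup>2) (x * (x * v * inverse (1 - x)))
    \<longleftrightarrow> E (x * (y + z)) z v = 0"
proof -
  define p where "p = x * (y + z)"
  have tp: "t * p = y + z" unfolding p_def mult.assoc[symmetric] assms(1) by simp
  have "x * (x * v * inverse (1 - x)) * t * (t - 1) = (t * x) * (t * x - x) * v * inverse (1 - x)"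
    by (simp add: algebra_simps)
  also have "\<dots> = v" using assms by simp
  finally have 1: "x * (x * v * inverse (1 - x)) * t * (t - 1) = v" .
  have "t * (p - \<nu>\<^sup>2) - (- \<nu>\<^sup>2 * t + a + y) = z - a"
    using tp by (simp add: algebra_simps)
  then have 2: "2 * (p - \<nu>\<^sup>2) * (t * (p - \<nu>\<^sup>2) - (- \<nu>\<^sup>2 * t + a + y)) - (p - \<nu>\<^sup>2)\<^sup>2 - \<nu>\<^sup>2 * \<nu>3 * \<nu>4 = quad p z"
    by (simp add: quad_def a_def b_def field_simps power2_eq_square)
  show ?thesis
    unfolding ode_def p_def[symmetric] 1 2 E_def \<alpha>_def \<beta>_def by (simp add: diff_diff_eq2 add_diff_eq diff_add_eq)
qed

text \<open>Multiplication by \<open>q\<close> undoes the shift of the eigenvalues by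
  \<open>2 \<nu>\<close>. In the third claim the derivative \<open>- x\<close> of \<open>x\<close>
  cancels the term \<open>y + z\<close>, so that the derivative of \<open>p\<close> involves
  \<open>v\<close> alone.\<close>

lemma yz_derivatives:
  assumes Y: "(Y has_field_derivative (1 + 2 * \<nu>) * Y w + Z w) (at w)"
    and Z: "(Z has_field_derivative 2 * \<nu> * Z w + V w * r) (at w)"
    and r: "r = 1 + exp (- w) * r"
  shows "((\<lambda>w. exp (- 2 * \<nu> * w) * Y w) has_field_derivative exp (- 2 * \<nu> * w) * Y w + exp (- 2 * \<nu> * w) * Z w) (at w)"
    and "((\<lambda>w. exp (- 2 * \<nu> * w) * Z w) has_field_derivative exp (- 2 * \<nu> * w) * V w * r) (at w)"
    and "((\<lambda>w. exp (- w) * (exp (- 2 * \<nu> * w) * Y w + exp (- 2 * \<nu> * w) * Z w)) has_field_derivative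
      exp (- w) * (exp (- 2 * \<nu> * w) * V w) * r) (at w)"
proof -
  have q: "((\<lambda>w. exp (- 2 * \<nu> * w)) has_field_derivative exp (- 2 * \<nu> * w) * (- 2 * \<nu>)) (at w)"
    by (auto intro!: derivative_eq_intros)
  have x: "((\<lambda>w. exp (- w)) has_field_derivative - exp (- w)) (at w)"
    by (auto intro!: derivative_eq_intros)
  from DERIV_mult[OF q Y]
  show 1: "((\<lambda>w. exp (- 2 * \<nu> * w) * Y w) has_field_derivative exp (- 2 * \<nu> * w) * Y w + exp (- 2 * \<nu> * w) * Z w) (at w)"
    by (simp add: algebra_simps)
  from DERIV_mult[OF q Z]
  show 2: "((\<lambda>w. exp (- 2 * \<nu> * w) * Z w) has_field_derivative exp (- 2 * \<nu> * w) * V w * r) (at w)"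
    by (simp add: algebra_simps)
  from DERIV_mult[OF x DERIV_add[OF 1 2]]
  show "((\<lambda>w. exp (- w) * (exp (- 2 * \<nu> * w) * Y w + exp (- 2 * \<nu> * w) * Z w)) has_field_derivative
      exp (- w) * (exp (- 2 * \<nu> * w) * V w) * r) (at w)"
    by (simp add: algebra_simps)
qed

text \<open>\<open>Y\<close>, \<open>Z\<close>, \<open>V\<close> are bounded and \<open>q\<close>
  tends to 0 since \<open>Re \<nu> > 0\<close>; this forces the constant value of \<open>E\<close>
  to be 0. The bound \<open>Y - C = O(|x|)\<close> is stronger than the asymptotics require.\<close>

lemma solution_log_exists: "\<exists>u. solution_log \<nu> \<nu>3 \<nu>4 C A B u"
proof -
  obtain R K Y Z V where R: "0 \<le> R" "0 \<le> K"
    and sys: "\<And>w. w \<in> halfstrip A B R \<Longrightarrow> sys Y Z V w"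
    and den: "\<And>w. w \<in> halfstrip A B R \<Longrightarrow> den (exp (- w)) (exp (- w) * (exp (- 2 * \<nu> * w) * (Y w + Z w))) \<noteq> 0"
    and YC: "\<And>w. w \<in> halfstrip A B R \<Longrightarrow> norm (Y w - C) \<le> K * exp (- Re w)"
    and bd: "\<And>w. w \<in> halfstrip A B R \<Longrightarrow> norm (Y w) \<le> K \<and> norm (Z w) \<le> K \<and> norm (V w) \<le> K"
    by (rule sys_solution[of A B]) blast
  define H where "H = halfstrip A B R"
  note openH = open_halfstrip[of A B R, folded H_def] and convH = convex_halfstrip[of A B R, folded H_def]
  define q where "q w = exp (- 2 * \<nu> * w)" for w
  define y where "y w = q w * Y w" for w
  define z where "z w = q w * Z w" for w
  define v where "v w = q w * V w" for w
  define p where "p w = exp (- w) * (y w + z w)" for w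
  define r where "r w = inverse (1 - exp (- w))" for w :: complex
  define u where "u w = - \<nu>\<^sup>2 * exp w + a + y w" for w
  have nz: "exp (- w) \<noteq> 1" if "w \<in> H" for w using sysD(1)[OF sys] that by (simp add: H_def)
  have r: "r w = 1 + exp (- w) * r w" if "w \<in> H" for w
    using nz[OF that] by (simp add: r_def field_simps)
  have dy: "(y has_field_derivative y w + z w) (at w)" and dz: "(z has_field_derivative v w * r w) (at w)"
    and dp: "(p has_field_derivative exp (- w) * v w * r w) (at w)" if "w \<in> H" for w
  proof -
    have s: "sys Y Z V w" using sys that by (simp add: H_def)
    show "(y has_field_derivative y w + z w) (at w)" "(z has_field_derivative v w * r w) (at w)"
      "(p has_field_derivative exp (- w) * v w * r w) (at w)"
      using yz_derivatives[of Y w Z V "r w", OF sysD(2)[OF s] sysD(3)[OF s, folded r_def] r[OF that]]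
      by (simp_all add: y_def[abs_def] z_def[abs_def] v_def[abs_def] p_def[abs_def] q_def[abs_def] mult.assoc)
  qed
  have dv: "(v has_field_derivative 4 * \<nu>\<^sup>2 * z w + exp (- w) * (q w * G (exp (- w)) (q w) (Y w) (Z w) (V w))) (at w)"
    if "w \<in> H" for w
  proof -
    have "(q has_field_derivative q w * (- 2 * \<nu>)) (at w)"
      unfolding q_def by (auto intro!: derivative_eq_intros)
    from DERIV_mult[OF this sysD(4)[OF sys, of w, folded q_def]] that show ?thesis
      by (simp add: H_def v_def[abs_def] z_def algebra_simps)
  qed
  have dE: "((\<lambda>w. E (p w) (z w) (v w)) has_field_derivative 0) (at w)" if w: "w \<in> H" for w
  proof -
    have peq: "p w = exp (- w) * (q w * (Y w + Z w))" by (simp add: p_def y_def z_def algebra_simps)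
    have "bracket (exp (- w)) (p w) (z w) (v w) (4 * \<nu>\<^sup>2 * z w + exp (- w) * (q w * G (exp (- w)) (q w) (Y w) (Z w) (V w))) = 0"
      unfolding z_def v_def using den w by (subst bracket_eq_0_iff[OF peq]) (auto simp: peq H_def q_def)
    with E_has_derivative[OF nz[OF w] dp[OF w, unfolded r_def] dz[OF w, unfolded r_def] dv[OF w]]
    show ?thesis by simp
  qed
  have "\<exists>c. \<forall>w\<in>H. E (p w) (z w) (v w) = c"
    by (rule has_field_derivative_zero_constant[OF convH has_field_derivative_at_within[OF dE]])
  then obtain c where c: "\<And>w. w \<in> H \<Longrightarrow> E (p w) (z w) (v w) = c" by blast
  have E0: "E (p w) (z w) (v w) = 0" if w: "w \<in> H" for w
  proof -
    have q0: "((\<lambda>s. q (w + of_real s)) \<longlongrightarrow> 0) at_top"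
      using exp_ray_tendsto_0[of "2 * \<nu>" w] Re_\<nu> by (simp add: q_def)
    have x0: "((\<lambda>s. exp (- (w + of_real s))) \<longlongrightarrow> 0) at_top"
      using exp_ray_tendsto_0[of 1 w] by simp
    have null: "((\<lambda>s. q (w + of_real s) * F (w + of_real s)) \<longlongrightarrow> 0) at_top"
      if F: "\<And>w. w \<in> H \<Longrightarrow> norm (F w) \<le> K" for F
    proof (rule Lim_null_comparison)
      show "((\<lambda>s. norm (q (w + of_real s)) * K) \<longlongrightarrow> 0) at_top"
        using tendsto_mult_left_zero[OF tendsto_norm_zero[OF q0]] .
      show "\<forall>\<^sub>F s in at_top. norm (q (w + of_real s) * F (w + of_real s)) \<le> norm (q (w + of_real s)) * K"
        using eventually_ge_at_top[of 0]
      proof eventually_elim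
        case (elim s)
        then show ?case unfolding norm_mult
          using F[of "w + of_real s"] w by (intro mult_left_mono) (auto simp: H_def halfstrip_add_real)
      qed
    qed
    have "((\<lambda>s. y (w + of_real s)) \<longlongrightarrow> 0) at_top" "((\<lambda>s. z (w + of_real s)) \<longlongrightarrow> 0) at_top"
      "((\<lambda>s. v (w + of_real s)) \<longlongrightarrow> 0) at_top"
      unfolding y_def z_def v_def using bd by (auto intro!: null simp: H_def)
    then have "((\<lambda>s. E (p (w + of_real s)) (z (w + of_real s)) (v (w + of_real s))) \<longlongrightarrow>
        E (0 * (0 + 0)) 0 0) at_top"
      unfolding E_def quad_def p_def by (intro tendsto_intros x0)
    moreover have "\<forall>\<^sub>F s in at_top. E (p (w + of_real s)) (z (w + of_real s)) (v (w + of_real s)) = c"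
      using eventually_ge_at_top[of 0] by eventually_elim (use w c in \<open>auto simp: H_def halfstrip_add_real\<close>)
    ultimately have "((\<lambda>s::real. c) \<longlongrightarrow> E (0 * (0 + 0)) 0 0) at_top"
      using tendsto_cong by force
    then have "c = E (0 * (0 + 0)) 0 0"
      by (simp add: tendsto_const_iff)
    then show ?thesis using c[OF w] by (simp add: E_def quad_def)
  qed
  have du: "(u has_field_derivative - \<nu>\<^sup>2 * exp w + (y w + z w)) (at w)" if "w \<in> H" for w
    unfolding u_def by (auto intro!: derivative_eq_intros dy[OF that])
  have dtu: "deriv_t u w = p w - \<nu>\<^sup>2" if "w \<in> H" for w
    using DERIV_imp_deriv[OF du[OF that]] by (simp add: deriv_t_def p_def exp_minus field_simps)
  have ddtu: "deriv_t (deriv_t u) w = exp (- w) * (exp (- w) * v w * r w)" if "w \<in> H" for w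
  proof -
    have "((\<lambda>w. p w - \<nu>\<^sup>2) has_field_derivative exp (- w) * v w * r w) (at w)"
      using DERIV_diff[OF dp[OF that] DERIV_const] by simp
    \<comment> \<open>The formula for \<open>deriv_t u\<close> holds on an open set and may
      therefore be differentiated.\<close>
    then have "(deriv_t u has_field_derivative exp (- w) * v w * r w) (at w)"
      by (rule has_field_derivative_transform_within_open[OF _ openH that]) (simp add: dtu)
    from DERIV_imp_deriv[OF this] show ?thesis unfolding deriv_t_def[of "deriv_t u"]
      by (simp add: exp_minus field_simps)
  qed
  have "solution_log \<nu> \<nu>3 \<nu>4 C A B u"
    unfolding solution_log_def
  proof (intro conjI exI[of _ "exp R"])
    have eq: "{w \<in> log_sector A B. norm (exp w) > exp R} = H"
      using halfstrip_eq_log_sector[of "exp R" A B] by (simp add: H_def)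
    show "0 < exp R" by simp
    show "u analytic_on {w \<in> log_sector A B. norm (exp w) > exp R}"
      unfolding eq analytic_on_open[OF openH] holomorphic_on_open[OF openH] using du by blast
    show "\<forall>w\<in>log_sector A B. norm (exp w) > exp R \<longrightarrow>
      ode \<nu> \<nu>3 \<nu>4 (exp w) (u w) (deriv_t u w) (deriv_t (deriv_t u) w)"
    proof (intro ballI impI)
      fix w assume "w \<in> log_sector A B" "norm (exp w) > exp R"
      then have w: "w \<in> H" using eq by blast
      have "exp w * exp (- w) = 1" by (simp add: exp_add[symmetric])
      from ode_iff_E[OF this nz[OF w], of "y w" "z w" "v w"] E0[OF w]
      show "ode \<nu> \<nu>3 \<nu>4 (exp w) (u w) (deriv_t u w) (deriv_t (deriv_t u) w)"
        unfolding dtu[OF w] ddtu[OF w] u_def p_def r_def by simp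
    qed
    show "((\<lambda>w. (u w - expansion \<nu> \<nu>3 \<nu>4 C (exp w) w) * exp (2 * \<nu> * w)) \<longlongrightarrow> 0)
      (inf (filtercomap exp at_infinity) (principal (log_sector A B)))"
    proof (rule tendstoI)
      fix e :: real assume e: "e > 0"
      \<comment> \<open>\<open>K + 1\<close> in place of \<open>K\<close> gives a strict inequality
        and a positive argument of \<open>ln\<close>.\<close>
      define R' where "R' = max R (ln ((K + 1) / e))"
      have "norm ((u w - expansion \<nu> \<nu>3 \<nu>4 C (exp w) w) * exp (2 * \<nu> * w)) < e" if "w \<in> halfstrip A B R'" for w
      proof -
        have "(u w - expansion \<nu> \<nu>3 \<nu>4 C (exp w) w) * exp (2 * \<nu> * w) = (Y w - C) * (exp (- 2 * \<nu> * w) * exp (2 * \<nu> * w))"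
          by (simp add: u_def expansion_def a_def y_def q_def algebra_simps)
        also have "\<dots> = Y w - C" by (simp add: exp_add[symmetric])
        also have "norm (Y w - C) \<le> K * exp (- Re w)"
          using that halfstrip_mono[of R R'] by (intro YC) (auto simp: R'_def)
        also have "\<dots> < (K + 1) * exp (- ln ((K + 1) / e))"
          using that R by (intro mult_strict_mono' ) (auto simp: halfstrip_def R'_def)
        also have "\<dots> = e" using R e by (simp add: exp_minus field_simps)
        finally show ?thesis .
      qed
      then show "\<forall>\<^sub>F w in inf (filtercomap exp at_infinity) (principal (log_sector A B)).
          dist ((u w - expansion \<nu> \<nu>3 \<nu>4 C (exp w) w) * exp (2 * \<nu> * w)) 0 < e"
        unfolding eventually_log_sector_at_infinity by (auto simp: dist_norm)
    qed
  qed
  then show ?thesis by blast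
qed


text \<open>\<open>Z\<close> and \<open>V\<close> are defined by solving the first two equations of
  the system, so only the equation for \<open>V\<close> has content. It is obtained merely for far
  points of the ray, where \<open>p\<close> is close enough to 0 to ensure
  \<open>den \<noteq> 0\<close>.\<close>

lemma solution_log_imp_sys:
  assumes sol: "solution_log \<nu> \<nu>3 \<nu>4 C A B u" and w0: "A < Im w0" "Im w0 < B"
  obtains Y Z V where "\<And>w. Y w = (u w + \<nu>\<^sup>2 * exp w - a) * exp (2 * \<nu> * w)"
    "\<forall>\<^sub>F s in at_top. sys Y Z V (w0 + of_real s)"
    "\<And>i. ((\<lambda>s. coord Y Z V i (w0 + of_real s)) \<longlongrightarrow> 0) at_top"
proof -
  obtain \<rho> where \<rho>: "\<rho> > 0" "u analytic_on {w \<in> log_sector A B. norm (exp w) > \<rho>}"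
    and ode: "\<And>w. w \<in> log_sector A B \<Longrightarrow> norm (exp w) > \<rho> \<Longrightarrow>
        ode \<nu> \<nu>3 \<nu>4 (exp w) (u w) (deriv_t u w) (deriv_t (deriv_t u) w)"
    and lim: "((\<lambda>w. (u w - expansion \<nu> \<nu>3 \<nu>4 C (exp w) w) * exp (2 * \<nu> * w)) \<longlongrightarrow> 0)
      (inf (filtercomap exp at_infinity) (principal (log_sector A B)))"
    using sol unfolding solution_log_def by blast
  \<comment> \<open>The entry 0 ensures \<open>|x| < 1\<close>, hence
    \<open>1 - x \<noteq> 0\<close>.\<close>
  define R where "R = max 0 (ln \<rho>)"
  define H where "H = halfstrip A B R"
  note openH = open_halfstrip[of A B R, folded H_def] and convH = convex_halfstrip[of A B R, folded H_def]
  have sub: "H \<subseteq> {w \<in> log_sector A B. norm (exp w) > \<rho>}"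
    unfolding halfstrip_eq_log_sector[OF \<rho>(1)] H_def by (rule halfstrip_mono) (simp add: R_def)
  have hol: "u holomorphic_on H"
    using analytic_imp_holomorphic[OF \<rho>(2)] sub by (rule holomorphic_on_subset)
  have nz: "exp (- w) \<noteq> 1" if "w \<in> H" for w
  proof -
    have "norm (exp (- w)) < 1" using that by (simp add: H_def halfstrip_def R_def)
    then show ?thesis by (metis less_irrefl norm_one)
  qed
  define Y where "Y w = (u w + \<nu>\<^sup>2 * exp w - a) * exp (2 * \<nu> * w)" for w
  define Z where "Z w = deriv Y w - (1 + 2 * \<nu>) * Y w" for w
  define V where "V w = (1 - exp (- w)) * (deriv Z w - 2 * \<nu> * Z w)" for w
  have holY: "Y holomorphic_on H" unfolding Y_def by (intro holomorphic_intros hol)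
  have holZ: "Z holomorphic_on H" unfolding Z_def by (intro holomorphic_intros holY openH)
  have holV: "V holomorphic_on H" unfolding V_def by (intro holomorphic_intros holZ openH)
  define q where "q w = exp (- 2 * \<nu> * w)" for w
  define y where "y w = q w * Y w" for w
  define z where "z w = q w * Z w" for w
  define v where "v w = q w * V w" for w
  define p where "p w = exp (- w) * (y w + z w)" for w
  define r where "r w = inverse (1 - exp (- w))" for w :: complex
  have holv: "v holomorphic_on H" unfolding v_def q_def by (intro holomorphic_intros holV)
  have holz: "z holomorphic_on H" unfolding z_def q_def by (intro holomorphic_intros holZ)
  have holp: "p holomorphic_on H" unfolding p_def y_def q_def by (intro holomorphic_intros holY holz)
  have dY: "(Y has_field_derivative (1 + 2 * \<nu>) * Y w + Z w) (at w)"
    and dZ: "(Z has_field_derivative 2 * \<nu> * Z w + V w * r w) (at w)"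
    and dv: "(v has_field_derivative deriv v w) (at w)" if "w \<in> H" for w
  proof -
    have "V w * r w = deriv Z w - 2 * \<nu> * Z w" using nz[OF that] by (simp add: V_def r_def)
    then show "(Z has_field_derivative 2 * \<nu> * Z w + V w * r w) (at w)"
      using holomorphic_derivI[OF holZ openH that] by simp
    show "(Y has_field_derivative (1 + 2 * \<nu>) * Y w + Z w) (at w)" "(v has_field_derivative deriv v w) (at w)"
      using holomorphic_derivI[OF holY openH that] holomorphic_derivI[OF holv openH that]
      by (simp_all add: Z_def)
  qed
  have r: "r w = 1 + exp (- w) * r w" if "w \<in> H" for w
    using nz[OF that] by (simp add: r_def field_simps)
  have dy: "(y has_field_derivative y w + z w) (at w)" and dz: "(z has_field_derivative v w * r w) (at w)"
    and dp: "(p has_field_derivative exp (- w) * v w * r w) (at w)" if "w \<in> H" for w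
    using yz_derivatives[of Y w Z V "r w", OF dY[OF that] dZ[OF that] r[OF that]]
    by (simp_all add: y_def[abs_def] z_def[abs_def] v_def[abs_def] p_def[abs_def] q_def[abs_def] mult.assoc)
  have u: "u w = - \<nu>\<^sup>2 * exp w + a + y w" for w
  proof -
    have "y w = (u w + \<nu>\<^sup>2 * exp w - a) * (exp (2 * \<nu> * w) * exp (- 2 * \<nu> * w))"
      by (simp add: y_def Y_def q_def)
    then show ?thesis by (simp add: exp_add[symmetric])
  qed
  have du: "(u has_field_derivative - \<nu>\<^sup>2 * exp w + (y w + z w)) (at w)" if "w \<in> H" for w
    unfolding u by (auto intro!: derivative_eq_intros dy[OF that])
  have dtu: "deriv_t u w = p w - \<nu>\<^sup>2" if "w \<in> H" for w
    using DERIV_imp_deriv[OF du[OF that]] by (simp add: deriv_t_def p_def exp_minus field_simps)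
  have ddtu: "deriv_t (deriv_t u) w = exp (- w) * (exp (- w) * v w * r w)" if "w \<in> H" for w
  proof -
    have "((\<lambda>w. p w - \<nu>\<^sup>2) has_field_derivative exp (- w) * v w * r w) (at w)"
      using DERIV_diff[OF dp[OF that] DERIV_const] by simp
    then have "(deriv_t u has_field_derivative exp (- w) * v w * r w) (at w)"
      by (rule has_field_derivative_transform_within_open[OF _ openH that]) (simp add: dtu)
    from DERIV_imp_deriv[OF this] show ?thesis unfolding deriv_t_def[of "deriv_t u"]
      by (simp add: exp_minus field_simps)
  qed
  have E0: "E (p w) (z w) (v w) = 0" if w: "w \<in> H" for w
  proof -
    have "exp w * exp (- w) = 1" by (simp add: exp_add[symmetric])
    from ode_iff_E[OF this nz[OF w], of "y w" "z w" "v w"] ode[of w] w sub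
    show ?thesis unfolding dtu[OF w] ddtu[OF w] u p_def r_def by (auto simp: mult.assoc)
  qed
  have Eprod: "v w * bracket (exp (- w)) (p w) (z w) (v w) (deriv v w) = 0" if w: "w \<in> H" for w
  proof -
    have "((\<lambda>w. E (p w) (z w) (v w)) has_field_derivative 0) (at w)"
      by (rule has_field_derivative_transform_within_open[OF DERIV_const openH w]) (simp add: E0)
    from DERIV_unique[OF this E_has_derivative[OF nz[OF w] dp[OF w, unfolded r_def] dz[OF w, unfolded r_def] dv[OF w]]]
    show ?thesis using nz[OF w] by auto
  qed

  let ?w = "\<lambda>s. w0 + of_real s"
  let ?F = "inf (filtercomap exp at_infinity) (principal (log_sector A B))"
  have inH: "\<forall>\<^sub>F s in at_top. ?w s \<in> H"
    using eventually_gt_at_top[of "R - Re w0"] by eventually_elim (use w0 in \<open>auto simp: H_def halfstrip_def\<close>)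
  have YC: "(u w - expansion \<nu> \<nu>3 \<nu>4 C (exp w) w) * exp (2 * \<nu> * w) = Y w - C" for w
  proof -
    have "(u w - expansion \<nu> \<nu>3 \<nu>4 C (exp w) w) * exp (2 * \<nu> * w) = Y w - C * (exp (- 2 * \<nu> * w) * exp (2 * \<nu> * w))"
      by (simp add: Y_def expansion_def a_def algebra_simps)
    then show ?thesis by (simp add: exp_add[symmetric])
  qed
  have limYF: "((\<lambda>w. Y w - C) \<longlongrightarrow> 0) ?F" using lim unfolding YC .
  have hYC: "(\<lambda>w. Y w - C) holomorphic_on halfstrip A B R"
    using holY by (intro holomorphic_intros) (simp add: H_def)
  note lims = derivatives_tendsto_0_on_ray[OF hYC limYF w0]
  have dYC: "deriv (\<lambda>w. Y w - C) w = deriv Y w" if "w \<in> H" for w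
    using DERIV_imp_deriv[OF DERIV_diff[OF dY[OF that] DERIV_const, of C]] DERIV_imp_deriv[OF dY[OF that]] by simp
  have Ylim: "((\<lambda>s. Y (?w s)) \<longlongrightarrow> C) at_top"
    using lims[of 0] by (simp add: LIM_zero_iff)
  have Y1: "((\<lambda>s. deriv Y (?w s)) \<longlongrightarrow> 0) at_top"
  proof (rule Lim_transform_eventually)
    show "((\<lambda>s. deriv (\<lambda>w. Y w - C) (?w s)) \<longlongrightarrow> 0) at_top" using lims[of 1] by simp
    show "\<forall>\<^sub>F s in at_top. deriv (\<lambda>w. Y w - C) (?w s) = deriv Y (?w s)"
      using inH by eventually_elim (rule dYC)
  qed
  have Y2: "((\<lambda>s. deriv (deriv Y) (?w s)) \<longlongrightarrow> 0) at_top"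
  proof (rule Lim_transform_eventually)
    show "((\<lambda>s. deriv (deriv (\<lambda>w. Y w - C)) (?w s)) \<longlongrightarrow> 0) at_top"
      using lims[of 2] by (simp add: numeral_2_eq_2)
    show "\<forall>\<^sub>F s in at_top. deriv (deriv (\<lambda>w. Y w - C)) (?w s) = deriv (deriv Y) (?w s)"
      using inH
    proof eventually_elim
      case (elim s)
      have "(deriv (\<lambda>w. Y w - C) has_field_derivative deriv (deriv Y) (?w s)) (at (?w s))"
        by (rule has_field_derivative_transform_within_open[OF holomorphic_derivI[OF holomorphic_deriv[OF holY openH] openH elim] openH elim])
          (simp add: dYC)
      then show ?case by (rule DERIV_imp_deriv)
    qed
  qed
  define Z0 where "Z0 = - (1 + 2 * \<nu>) * C"
  have Zlim: "((\<lambda>s. Z (?w s)) \<longlongrightarrow> Z0) at_top"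
    unfolding Z_def Z0_def by (rule tendsto_eq_intros Y1 Ylim refl)+ (simp add: algebra_simps)
  have dZe: "deriv Z w = deriv (deriv Y) w - (1 + 2 * \<nu>) * deriv Y w" if "w \<in> H" for w
  proof -
    have "(Z has_field_derivative deriv (deriv Y) w - (1 + 2 * \<nu>) * deriv Y w) (at w)"
      unfolding Z_def[abs_def]
      by (intro DERIV_diff DERIV_cmult holomorphic_derivI[OF holY openH that] holomorphic_derivI[OF holomorphic_deriv[OF holY openH] openH that])
    then show ?thesis by (rule DERIV_imp_deriv)
  qed
  have "((\<lambda>s. deriv (deriv Y) (?w s) - (1 + 2 * \<nu>) * deriv Y (?w s)) \<longlongrightarrow> 0 - (1 + 2 * \<nu>) * 0) at_top"
    by (intro tendsto_intros Y1 Y2)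
  then have Z1: "((\<lambda>s. deriv Z (?w s)) \<longlongrightarrow> 0 - (1 + 2 * \<nu>) * 0) at_top"
    by (rule Lim_transform_eventually) (use inH in eventually_elim, simp add: dZe)
  have x0: "((\<lambda>s. exp (- ?w s)) \<longlongrightarrow> 0) at_top"
    using exp_ray_tendsto_0[of 1 w0] by simp
  have q0: "((\<lambda>s. q (?w s)) \<longlongrightarrow> 0) at_top"
    using exp_ray_tendsto_0[of "2 * \<nu>" w0] Re_\<nu> by (simp add: q_def)
  have Vlim: "((\<lambda>s. V (?w s)) \<longlongrightarrow> (1 - 0) * ((0 - (1 + 2 * \<nu>) * 0) - 2 * \<nu> * Z0)) at_top"
    unfolding V_def by (intro tendsto_intros x0 Z1 Zlim)
  have coord0: "((\<lambda>s. coord Y Z V i (?w s)) \<longlongrightarrow> 0) at_top" for i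
  proof (cases i)
    case CY
    have "((\<lambda>s. \<nu> * (Y (?w s) - C)) \<longlongrightarrow> \<nu> * (C - C)) at_top" by (intro tendsto_intros Ylim)
    then show ?thesis by (simp add: CY coord_simps)
  next
    case CM
    have "((\<lambda>s. V (?w s) + 2 * \<nu> * Z (?w s)) \<longlongrightarrow> (1 - 0) * ((0 - (1 + 2 * \<nu>) * 0) - 2 * \<nu> * Z0) + 2 * \<nu> * Z0) at_top"
      by (intro tendsto_intros Vlim Zlim)
    then show ?thesis by (simp add: CM coord_simps)
  next
    case CN
    have "((\<lambda>s. V (?w s) - 2 * \<nu> * Z (?w s) - N0) \<longlongrightarrow> (1 - 0) * ((0 - (1 + 2 * \<nu>) * 0) - 2 * \<nu> * Z0) - 2 * \<nu> * Z0 - N0) at_top"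
      by (intro tendsto_intros Vlim Zlim)
    moreover have "(1 - 0) * ((0 - (1 + 2 * \<nu>) * 0) - 2 * \<nu> * Z0) - 2 * \<nu> * Z0 - N0 = 0"
      by (simp add: Z0_def N0_def algebra_simps)
    ultimately show ?thesis by (simp add: CN coord_simps)
  qed
  have y0: "((\<lambda>s. y (?w s)) \<longlongrightarrow> 0 * C) at_top" and z0: "((\<lambda>s. z (?w s)) \<longlongrightarrow> 0 * Z0) at_top"
    unfolding y_def z_def by (intro tendsto_mult q0 Ylim Zlim)+
  have p0: "((\<lambda>s. p (?w s)) \<longlongrightarrow> 0) at_top"
    using tendsto_mult[OF x0 tendsto_add[OF y0 z0]] by (simp add: p_def)

  \<comment> \<open>Differentiating \<open>E = 0\<close> yields only \<open>v * bracket = 0\<close>.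
    If \<open>v\<close> vanishes identically, \<open>u\<close> is affine in \<open>t\<close>; then
    \<open>p\<close> and \<open>z\<close> are constant, the asymptotics force
    \<open>p = z = 0\<close>, and \<open>bracket\<close> vanishes there as well.\<close>
  have bracket0: "bracket (exp (- w)) (p w) (z w) (v w) (deriv v w) = 0" if w: "w \<in> H" for w
  proof (cases "\<forall>w\<in>H. v w = 0")
    case False
    show ?thesis
    proof (rule holomorphic_product_zero[OF openH convex_connected[OF convH] holv _ Eprod False w])
      show "(\<lambda>w. bracket (exp (- w)) (p w) (z w) (v w) (deriv v w)) holomorphic_on H"
        unfolding bracket_def den_def quad_def
        by (intro holomorphic_intros holp holz holv openH)
    qed
  next
    case True
    have const: "f w = 0" if d: "\<And>w. w \<in> H \<Longrightarrow> (f has_field_derivative 0) (at w)" and l: "((\<lambda>s. f (?w s)) \<longlongrightarrow> 0) at_top" for f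
    proof -
      obtain c where c: "\<And>w. w \<in> H \<Longrightarrow> f w = c"
        using has_field_derivative_zero_constant[OF convH has_field_derivative_at_within[OF d]] by blast
      have "\<forall>\<^sub>F s in at_top. f (?w s) = c" using inH by eventually_elim (rule c)
      then have "((\<lambda>s::real. c) \<longlongrightarrow> 0) at_top" using l tendsto_cong by force
      then show ?thesis using c[OF w] by (simp add: tendsto_const_iff)
    qed
    have "p w = 0" by (rule const[OF _ p0]) (use dp True in force)
    moreover have "z w = 0" by (rule const) (use dz True z0 in force)+
    moreover have "deriv v w = 0"
      by (rule DERIV_imp_deriv[OF has_field_derivative_transform_within_open[OF DERIV_const openH w]]) (use True in simp)
    ultimately show ?thesis using True w by (simp add: bracket_def quad_def)
  qed

  \<comment> \<open>Keeps \<open>p\<close> away from \<open>\<nu>^2\<close>, the zero of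
    \<open>den\<close>.\<close>
  have "\<forall>\<^sub>F s in at_top. dist (p (?w s)) 0 < norm (\<nu>\<^sup>2)"
    by (rule tendstoD[OF p0]) (use \<nu>_nz in simp)
  with inH have "\<forall>\<^sub>F s in at_top. sys Y Z V (?w s)"
  proof eventually_elim
    case (elim s)
    let ?v = "?w s"
    have w: "?v \<in> H" by (rule elim)
    have peq: "p ?v = exp (- ?v) * (q ?v * (Y ?v + Z ?v))" by (simp add: p_def y_def z_def algebra_simps)
    have "p ?v \<noteq> \<nu>\<^sup>2" using elim by auto
    then have "den (exp (- ?v)) (p ?v) \<noteq> 0" using nz[OF w] by (simp add: den_def)
    from bracket_eq_0_iff[OF peq this, where V = "V ?v" and v' = "deriv v ?v"] bracket0[OF w]
    have dv': "deriv v ?v = 4 * \<nu>\<^sup>2 * (q ?v * Z ?v) + exp (- ?v) * (q ?v * G (exp (- ?v)) (q ?v) (Y ?v) (Z ?v) (V ?v))"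
      by (simp add: z_def v_def)
    have qnz: "q ?v \<noteq> 0" by (simp add: q_def)
    have "(q has_field_derivative q ?v * (- 2 * \<nu>)) (at ?v)"
      unfolding q_def by (auto intro!: derivative_eq_intros)
    from DERIV_mult[OF this holomorphic_derivI[OF holV openH w]]
    have "deriv v ?v = q ?v * (- 2 * \<nu>) * V ?v + deriv V ?v * q ?v"
      unfolding v_def[abs_def] by (rule DERIV_imp_deriv)
    with dv' have "q ?v * deriv V ?v = q ?v * (2 * \<nu> * V ?v + 4 * \<nu>\<^sup>2 * Z ?v + exp (- ?v) * G (exp (- ?v)) (q ?v) (Y ?v) (Z ?v) (V ?v))"
      by (simp add: algebra_simps)
    then have dV: "deriv V ?v = 2 * \<nu> * V ?v + 4 * \<nu>\<^sup>2 * Z ?v + exp (- ?v) * G (exp (- ?v)) (q ?v) (Y ?v) (Z ?v) (V ?v)"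
      using qnz by simp
    show ?case
      unfolding sys_def using nz[OF w] dY[OF w] dZ[OF w, unfolded r_def]
        holomorphic_derivI[OF holV openH w, unfolded dV q_def] by blast
  qed
  then show thesis by (rule that[OF Y_def _ coord0])
qed

lemma solution_log_unique:
  assumes "A < B" and u: "solution_log \<nu> \<nu>3 \<nu>4 C A B u" and v: "solution_log \<nu> \<nu>3 \<nu>4 C A B v"
  shows "\<exists>R. \<forall>w\<in>log_sector A B. norm (exp w) > R \<longrightarrow> u w = v w"
proof -
  \<comment> \<open>Any interior ray would do; \<open>A < B\<close> provides the middle one.\<close>
  define w0 where "w0 = Complex 0 ((A + B) / 2)"
  have w0: "A < Im w0" "Im w0 < B" using assms(1) by (simp_all add: w0_def)
  let ?w = "\<lambda>s. w0 + of_real s"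
  obtain Y Z V where Y: "\<And>w. Y w = (u w + \<nu>\<^sup>2 * exp w - a) * exp (2 * \<nu> * w)"
    "\<forall>\<^sub>F s in at_top. sys Y Z V (?w s)" "\<And>i. ((\<lambda>s. coord Y Z V i (?w s)) \<longlongrightarrow> 0) at_top"
    by (rule solution_log_imp_sys[OF u w0]) blast
  obtain Y' Z' V' where Y': "\<And>w. Y' w = (v w + \<nu>\<^sup>2 * exp w - a) * exp (2 * \<nu> * w)"
    "\<forall>\<^sub>F s in at_top. sys Y' Z' V' (?w s)" "\<And>i. ((\<lambda>s. coord Y' Z' V' i (?w s)) \<longlongrightarrow> 0) at_top"
    by (rule solution_log_imp_sys[OF v w0]) blast
  obtain S where S: "\<And>s. S \<le> s \<Longrightarrow> Y (?w s) = Y' (?w s)"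
    using sys_unique_on_ray[OF w0 Y(2) Y'(2) Y(3) Y'(3)] by blast
  then have uv: "u (?w s) = v (?w s)" if "S \<le> s" for s
    using that by (simp add: Y(1) Y'(1))
  obtain \<rho>1 where \<rho>1: "\<rho>1 > 0" "u analytic_on {w \<in> log_sector A B. norm (exp w) > \<rho>1}"
    using u unfolding solution_log_def by blast
  obtain \<rho>2 where \<rho>2: "\<rho>2 > 0" "v analytic_on {w \<in> log_sector A B. norm (exp w) > \<rho>2}"
    using v unfolding solution_log_def by blast
  define R where "R = max (ln \<rho>1) (ln \<rho>2)"
  define H where "H = halfstrip A B R"
  \<comment> \<open>\<open>R + 1\<close> puts this piece of the ray inside the common half-strip.
    Being connected with more than one point, it has the limit point that the identity theorem
    needs.\<close>
  define T where "T = ?w ` {max S (R + 1)..}"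
  have hol: "(\<lambda>w. u w - v w) holomorphic_on H"
    using analytic_imp_holomorphic[OF \<rho>1(2)] analytic_imp_holomorphic[OF \<rho>2(2)]
    unfolding halfstrip_eq_log_sector[OF \<rho>1(1)] halfstrip_eq_log_sector[OF \<rho>2(1)] H_def
    by (intro holomorphic_intros; elim holomorphic_on_subset; intro halfstrip_mono) (simp_all add: R_def)
  have T: "T \<subseteq> H" using w0 by (auto simp: T_def H_def halfstrip_def w0_def)
  have "connected T"
    unfolding T_def by (intro connected_continuous_image continuous_intros) simp
  moreover have T0: "?w (max S (R + 1)) \<in> T" and "?w (max S (R + 1) + 1) \<in> T"
    unfolding T_def by (rule imageI, simp)+
  moreover have "?w (max S (R + 1)) \<noteq> ?w (max S (R + 1) + 1)" by simp
  ultimately have islim: "?w (max S (R + 1)) islimpt T"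
    by (intro connected_imp_perfect) auto
  have "u w - v w = 0" if "w \<in> H" for w
  proof (rule analytic_continuation[OF hol _ _ T _ islim _ that])
    show "open H" "connected H"
      unfolding H_def by (simp_all add: open_halfstrip convex_connected convex_halfstrip)
    show "?w (max S (R + 1)) \<in> H" using T T0 by blast
    show "u w - v w = 0" if "w \<in> T" for w using that uv by (auto simp: T_def)
  qed
  moreover have "{w \<in> log_sector A B. norm (exp w) > exp R} = H"
    using halfstrip_eq_log_sector[of "exp R" A B] by (simp add: H_def)
  ultimately show ?thesis by (intro exI[of _ "exp R"]) auto
qed

end

subsection \<open>Transfer to sectors in the punctured plane\<close>

lemma sector_log_eq:
  assumes "B \<le> A + 2 * pi" "w \<in> log_sector A B"
  shows "sector_log A B (exp w) = w"
  unfolding sector_log_def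
proof (rule the_equality)
  show "exp w = exp w \<and> A < Im w \<and> Im w < B" using assms(2) by (simp add: log_sector_def)
  show "v = w" if "exp v = exp w \<and> A < Im v \<and> Im v < B" for v
  proof (rule exp_complex_eqI)
    show "\<bar>Im v - Im w\<bar> < 2 * pi" using that assms by (auto simp: log_sector_def)
  qed (use that in simp)
qed

lemma exp_log_sector: "w \<in> log_sector A B \<Longrightarrow> exp w \<in> sector A B"
  unfolding sector_def log_sector_def mem_Collect_eq
  by (intro exI[of _ "exp (Re w)"] exI[of _ "Im w"]) (simp add: exp_eq_polar rcis_def)

lemma sector_log_mem:
  assumes "B \<le> A + 2 * pi" "t \<in> sector A B"
  shows "sector_log A B t \<in> log_sector A B" "exp (sector_log A B t) = t"
  using sector_log[OF assms] by (simp_all add: log_sector_def)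

lemma sector_eq_exp_image:
  assumes "B \<le> A + 2 * pi"
  shows "sector A B = exp ` log_sector A B"
proof
  show "sector A B \<subseteq> exp ` log_sector A B"
    using sector_log_mem[OF assms] by (metis image_eqI subsetI)
qed (use exp_log_sector in blast)

lemma open_log_sector: "open (log_sector A B)"
proof -
  have "log_sector A B = {w. A < Im w} \<inter> {w. Im w < B}" by (auto simp: log_sector_def)
  then show ?thesis by (simp add: open_Int open_halfspace_Im_gt open_halfspace_Im_lt)
qed

text \<open>An open strip of height at most \<open>2 * pi\<close> contains no two points that differ
  by a nonzero period of \<open>exp\<close>.\<close>

lemma inj_on_exp_log_sector:
  assumes "B \<le> A + 2 * pi"
  shows "inj_on exp (log_sector A B)"
  using sector_log_eq[OF assms] by (metis inj_onI)

lemma open_sector: "B \<le> A + 2 * pi \<Longrightarrow> open (sector A B)"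
  unfolding sector_eq_exp_image
  by (rule open_mapping_thm3[OF _ open_log_sector inj_on_exp_log_sector]) (auto intro: holomorphic_intros)

text \<open>\<open>sector_log\<close> is given by a definite description; its differentiability is
  taken from the holomorphic inverse of the injective map \<open>exp\<close> on the open strip, with
  which it agrees on the sector.\<close>

lemma sector_log_has_derivative:
  assumes AB: "B \<le> A + 2 * pi" and t: "t \<in> sector A B"
  shows "(sector_log A B has_field_derivative inverse t) (at t)"
proof -
  obtain g where g: "g holomorphic_on (exp ` log_sector A B)"
    "\<And>w. w \<in> log_sector A B \<Longrightarrow> deriv exp w * deriv g (exp w) = 1"
    "\<And>w. w \<in> log_sector A B \<Longrightarrow> g (exp w) = w"
    by (rule holomorphic_has_inverse[OF _ open_log_sector inj_on_exp_log_sector[OF AB]]) (auto intro: holomorphic_intros)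
  have g_eq: "g s = sector_log A B s" if "s \<in> sector A B" for s
    using g(3)[OF sector_log_mem(1)[OF AB that]] sector_log_mem(2)[OF AB that] by simp
  have "deriv exp (sector_log A B t) = t"
    using DERIV_imp_deriv[OF DERIV_exp] sector_log_mem(2)[OF AB t] by metis
  then have "t * deriv g t = 1"
    using g(2)[OF sector_log_mem(1)[OF AB t]] sector_log_mem(2)[OF AB t] by simp
  then have "deriv g t = inverse t"
    by (metis inverse_unique)
  moreover have "(g has_field_derivative deriv g t) (at t)"
    using g(1) open_sector[OF AB] t unfolding sector_eq_exp_image[OF AB, symmetric] by (rule holomorphic_derivI)
  ultimately have "(g has_field_derivative inverse t) (at t)" by simp
  then show ?thesis
    by (rule has_field_derivative_transform_within_open[OF _ open_sector[OF AB] t]) (rule g_eq)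
qed

lemma deriv_comp_sector_log:
  assumes AB: "B \<le> A + 2 * pi" and t: "t \<in> sector A B"
    and f: "f field_differentiable at (sector_log A B t)"
  shows "deriv (f \<circ> sector_log A B) t = deriv_t f (sector_log A B t)"
proof -
  have "(f \<circ> sector_log A B has_field_derivative deriv f (sector_log A B t) * inverse t) (at t)"
    using f t by (intro DERIV_chain sector_log_has_derivative[OF AB]) (simp_all add: field_differentiable_derivI)
  from DERIV_imp_deriv[OF this] show ?thesis
    by (simp add: deriv_t_def sector_log_mem(2)[OF AB t] divide_inverse)
qed

text \<open>Serves uniqueness, which is proved in the coordinate \<open>w\<close>. By the chain
  rule, composition with \<open>exp\<close> turns \<open>d/dt\<close> into
  \<open>deriv_t\<close>.\<close>

lemma solution_plane_imp_log:
  assumes AB: "B \<le> A + 2 * pi" and sol: "solution_plane \<nu>1 \<nu>3 \<nu>4 C A B u"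
  shows "solution_log \<nu>1 \<nu>3 \<nu>4 C A B (u \<circ> exp)"
proof -
  obtain \<rho> where \<rho>: "\<rho> > 0" and an: "u analytic_on {t \<in> sector A B. norm t > \<rho>}"
    and ode: "\<And>t. t \<in> sector A B \<Longrightarrow> norm t > \<rho> \<Longrightarrow> ode \<nu>1 \<nu>3 \<nu>4 t (u t) (deriv u t) (deriv (deriv u) t)"
    and lim: "((\<lambda>t. (u t - expansion \<nu>1 \<nu>3 \<nu>4 C t (sector_log A B t)) * exp (2 * \<nu>1 * sector_log A B t))
        \<longlongrightarrow> 0) (inf at_infinity (principal (sector A B)))"
    using sol unfolding solution_plane_def by blast
  let ?S = "{w \<in> log_sector A B. norm (exp w) > \<rho>}"
  have openS: "open ?S" unfolding halfstrip_eq_log_sector[OF \<rho>] by (rule open_halfstrip)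
  have img: "exp ` ?S \<subseteq> {t \<in> sector A B. norm t > \<rho>}" using exp_log_sector by auto
  have an': "u analytic_on {exp w}" if "w \<in> ?S" for w
    using analytic_on_subset[OF an, of "{exp w}"] img that by auto
  have d1: "deriv_t (u \<circ> exp) w = deriv u (exp w)" if "w \<in> ?S" for w
    using an'[OF that] by (intro deriv_t_comp_exp analytic_on_imp_differentiable_at[of u "{exp w}"]) auto
  have d2: "deriv_t (deriv_t (u \<circ> exp)) w = deriv (deriv u) (exp w)" if w: "w \<in> ?S" for w
  proof -
    \<comment> \<open>\<open>d1\<close> holds in a whole neighbourhood of \<open>w\<close>, so both
      sides may be differentiated once more.\<close>
    have "deriv (deriv_t (u \<circ> exp)) w = deriv (deriv u \<circ> exp) w"
    proof (rule deriv_cong_ev[OF _ refl])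
      show "\<forall>\<^sub>F z in nhds w. deriv_t (u \<circ> exp) z = (deriv u \<circ> exp) z"
        using eventually_nhds_in_open[OF openS w] by eventually_elim (simp add: d1)
    qed
    then have "deriv_t (deriv_t (u \<circ> exp)) w = deriv_t (deriv u \<circ> exp) w" by (simp add: deriv_t_def)
    also have "\<dots> = deriv (deriv u) (exp w)"
      using analytic_deriv[OF an'[OF w]] by (intro deriv_t_comp_exp analytic_on_imp_differentiable_at[of _ "{exp w}"]) auto
    finally show ?thesis .
  qed
  have fl: "filterlim exp (inf at_infinity (principal (sector A B))) (inf (filtercomap exp at_infinity) (principal (log_sector A B)))"
    unfolding filterlim_inf filterlim_principal
  proof
    show "filterlim exp at_infinity (inf (filtercomap exp at_infinity) (principal (log_sector A B)))"
      by (rule filterlim_mono[OF filterlim_filtercomap order_refl inf_le1])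
    show "\<forall>\<^sub>F w in inf (filtercomap exp at_infinity) (principal (log_sector A B)). exp w \<in> sector A B"
      unfolding eventually_inf_principal using exp_log_sector by (simp add: always_eventually)
  qed
  show ?thesis
    unfolding solution_log_def
  proof (intro conjI exI[of _ \<rho>] \<rho> ballI impI)
    show "u \<circ> exp analytic_on ?S"
      by (rule analytic_on_compose[OF _ analytic_on_subset[OF an img]])
        (unfold analytic_on_open[OF openS], intro holomorphic_intros)
    show "ode \<nu>1 \<nu>3 \<nu>4 (exp w) ((u \<circ> exp) w) (deriv_t (u \<circ> exp) w) (deriv_t (deriv_t (u \<circ> exp)) w)"
      if "w \<in> log_sector A B" "norm (exp w) > \<rho>" for w
      using ode[OF exp_log_sector[OF that(1)] that(2)] d1[of w] d2[of w] that by simp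
    have "\<forall>\<^sub>F w in inf (filtercomap exp at_infinity) (principal (log_sector A B)). sector_log A B (exp w) = w"
      unfolding eventually_inf_principal using sector_log_eq[OF AB] by (simp add: always_eventually)
    then have "\<forall>\<^sub>F w in inf (filtercomap exp at_infinity) (principal (log_sector A B)).
        (u (exp w) - expansion \<nu>1 \<nu>3 \<nu>4 C (exp w) (sector_log A B (exp w))) * exp (2 * \<nu>1 * sector_log A B (exp w))
        = ((u \<circ> exp) w - expansion \<nu>1 \<nu>3 \<nu>4 C (exp w) w) * exp (2 * \<nu>1 * w)"
      by eventually_elim simp
    with filterlim_compose[OF lim fl]
    show "((\<lambda>w. ((u \<circ> exp) w - expansion \<nu>1 \<nu>3 \<nu>4 C (exp w) w) * exp (2 * \<nu>1 * w)) \<longlongrightarrow> 0)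
        (inf (filtercomap exp at_infinity) (principal (log_sector A B)))"
      by (rule Lim_transform_eventually)
  qed
qed

text \<open>Serves existence. As the opening is at most \<open>2 * pi\<close>,
  \<open>sector_log\<close> is a holomorphic inverse of \<open>exp\<close> on the sector.\<close>

lemma solution_log_imp_plane:
  assumes AB: "B \<le> A + 2 * pi" and sol: "solution_log \<nu>1 \<nu>3 \<nu>4 C A B u"
  shows "solution_plane \<nu>1 \<nu>3 \<nu>4 C A B (u \<circ> sector_log A B)"
proof -
  obtain \<rho> where \<rho>: "\<rho> > 0" and an: "u analytic_on {w \<in> log_sector A B. norm (exp w) > \<rho>}"
    and ode: "\<And>w. w \<in> log_sector A B \<Longrightarrow> norm (exp w) > \<rho> \<Longrightarrow>
        ode \<nu>1 \<nu>3 \<nu>4 (exp w) (u w) (deriv_t u w) (deriv_t (deriv_t u) w)"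
    and lim: "((\<lambda>w. (u w - expansion \<nu>1 \<nu>3 \<nu>4 C (exp w) w) * exp (2 * \<nu>1 * w)) \<longlongrightarrow> 0)
      (inf (filtercomap exp at_infinity) (principal (log_sector A B)))"
    using sol unfolding solution_log_def by blast
  let ?S = "{w \<in> log_sector A B. norm (exp w) > \<rho>}" and ?T = "{t \<in> sector A B. norm t > \<rho>}"
  let ?l = "sector_log A B"
  have openS: "open ?S" unfolding halfstrip_eq_log_sector[OF \<rho>] by (rule open_halfstrip)
  have "?T = sector A B \<inter> norm -` {\<rho><..}" by auto
  then have openT: "open ?T"
    using open_sector[OF AB] by (simp add: open_Int open_vimage[OF _ continuous_on_norm_id])
  have lS: "?l t \<in> ?S" if "t \<in> ?T" for t
    using sector_log_mem[OF AB, of t] that by (auto simp del: norm_exp_eq_Re)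
  have hol: "u holomorphic_on ?S" using an by (rule analytic_imp_holomorphic)
  have hol': "deriv_t u holomorphic_on ?S"
    unfolding deriv_t_def[abs_def] by (intro holomorphic_intros hol openS) auto
  have diff: "f field_differentiable at (?l t)" if "f holomorphic_on ?S" "t \<in> ?T" for f t
    using holomorphic_on_imp_differentiable_at[OF that(1) openS lS[OF that(2)]] .
  have d1: "deriv (u \<circ> ?l) t = deriv_t u (?l t)" if "t \<in> ?T" for t
    using that by (intro deriv_comp_sector_log[OF AB] diff[OF hol]) auto
  have d2: "deriv (deriv (u \<circ> ?l)) t = deriv_t (deriv_t u) (?l t)" if t: "t \<in> ?T" for t
  proof -
    have "deriv (deriv (u \<circ> ?l)) t = deriv (deriv_t u \<circ> ?l) t"
    proof (rule deriv_cong_ev[OF _ refl])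
      show "\<forall>\<^sub>F z in nhds t. deriv (u \<circ> ?l) z = (deriv_t u \<circ> ?l) z"
        using eventually_nhds_in_open[OF openT t] by eventually_elim (simp add: d1)
    qed
    also have "\<dots> = deriv_t (deriv_t u) (?l t)"
      using t by (intro deriv_comp_sector_log[OF AB] diff[OF hol']) auto
    finally show ?thesis .
  qed
  have fl: "filterlim ?l (inf (filtercomap exp at_infinity) (principal (log_sector A B))) (inf at_infinity (principal (sector A B)))"
    unfolding filterlim_inf filterlim_principal filterlim_filtercomap_iff
  proof
    have "filterlim (\<lambda>t::complex. t) at_infinity (inf at_infinity (principal (sector A B)))"
      by (rule filterlim_mono[OF filterlim_ident order_refl inf_le1])
    then show "filterlim (exp \<circ> ?l) at_infinity (inf at_infinity (principal (sector A B)))"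
      by (rule filterlim_mono_eventually[OF _ order_refl order_refl])
        (simp add: eventually_inf_principal sector_log_mem[OF AB] always_eventually)
    show "\<forall>\<^sub>F t in inf at_infinity (principal (sector A B)). ?l t \<in> log_sector A B"
      unfolding eventually_inf_principal using sector_log_mem[OF AB] by (simp add: always_eventually)
  qed
  show ?thesis
    unfolding solution_plane_def
  proof (intro conjI exI[of _ \<rho>] \<rho> ballI impI)
    have "(u \<circ> ?l) field_differentiable at t" if "t \<in> ?T" for t
      using that diff[OF hol that] sector_log_has_derivative[OF AB, of t]
      by (intro field_differentiable_compose) (auto simp: field_differentiable_def)
    then show "u \<circ> ?l analytic_on ?T"
      unfolding analytic_on_open[OF openT] holomorphic_on_def by (auto intro: field_differentiable_at_within)
    show "ode \<nu>1 \<nu>3 \<nu>4 t ((u \<circ> ?l) t) (deriv (u \<circ> ?l) t) (deriv (deriv (u \<circ> ?l)) t)"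
      if "t \<in> sector A B" "norm t > \<rho>" for t
      using ode[of "?l t"] lS[of t] d1[of t] d2[of t] sector_log_mem(2)[OF AB that(1)] that by simp
    have "\<forall>\<^sub>F t in inf at_infinity (principal (sector A B)). exp (?l t) = t"
      unfolding eventually_inf_principal using sector_log_mem[OF AB] by (simp add: always_eventually)
    then have "\<forall>\<^sub>F t in inf at_infinity (principal (sector A B)).
        (u (?l t) - expansion \<nu>1 \<nu>3 \<nu>4 C (exp (?l t)) (?l t)) * exp (2 * \<nu>1 * ?l t)
        = ((u \<circ> ?l) t - expansion \<nu>1 \<nu>3 \<nu>4 C t (?l t)) * exp (2 * \<nu>1 * ?l t)"
      by eventually_elim simp
    with filterlim_compose[OF lim fl]
    show "((\<lambda>t. ((u \<circ> ?l) t - expansion \<nu>1 \<nu>3 \<nu>4 C t (?l t)) * exp (2 * \<nu>1 * ?l t)) \<longlongrightarrow> 0)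
        (inf at_infinity (principal (sector A B)))"
      by (rule Lim_transform_eventually)
  qed
qed

theorem proposition1:
  fixes \<nu>1 \<nu>3 \<nu>4 C :: complex and A B :: real
  assumes "Re \<nu>1 > 0" and "A < B"
  shows "if B \<le> A + 2 * pi then
      (\<exists>u. solution_plane \<nu>1 \<nu>3 \<nu>4 C A B u) \<and>
      (\<forall>u v. solution_plane \<nu>1 \<nu>3 \<nu>4 C A B u \<and> solution_plane \<nu>1 \<nu>3 \<nu>4 C A B v \<longrightarrow>
         (\<exists>R. \<forall>t \<in> sector A B. norm t > R \<longrightarrow> u t = v t))
    else
      (\<exists>u. solution_log \<nu>1 \<nu>3 \<nu>4 C A B u) \<and>
      (\<forall>u v. solution_log \<nu>1 \<nu>3 \<nu>4 C A B u \<and> solution_log \<nu>1 \<nu>3 \<nu>4 C A B v \<longrightarrow>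
         (\<exists>R. \<forall>w \<in> log_sector A B. norm (exp w) > R \<longrightarrow> u w = v w))"
proof -
  interpret painleve \<nu>1 \<nu>3 \<nu>4 C by unfold_locales (rule assms(1))
  show ?thesis
  proof (cases "B \<le> A + 2 * pi")
    case AB: True
    have "\<exists>u. solution_plane \<nu>1 \<nu>3 \<nu>4 C A B u"
      using solution_log_exists solution_log_imp_plane[OF AB] by blast
    moreover have "\<exists>R. \<forall>t \<in> sector A B. norm t > R \<longrightarrow> u t = v t"
      if uv: "solution_plane \<nu>1 \<nu>3 \<nu>4 C A B u" "solution_plane \<nu>1 \<nu>3 \<nu>4 C A B v" for u v
    proof -
      obtain R where R: "\<And>w. w \<in> log_sector A B \<Longrightarrow> norm (exp w) > R \<Longrightarrow> (u \<circ> exp) w = (v \<circ> exp) w"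
        using solution_log_unique[OF assms(2) solution_plane_imp_log[OF AB uv(1)] solution_plane_imp_log[OF AB uv(2)]] by blast
      then show ?thesis
        \<comment> \<open>\<open>exp\<close> maps the strip onto the sector, so equality at every
          far \<open>w\<close> gives equality at every far \<open>t\<close>.\<close>
        unfolding sector_eq_exp_image[OF AB] by (intro exI[of _ R]) auto
    qed
    ultimately show ?thesis using AB by simp
  next
    case False
    then show ?thesis using solution_log_exists solution_log_unique[OF assms(2)] by simp
  qed
qed

end
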